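(* There exists a pair of connected compact metrizable spaces, each with the $\mathcal{AF}$-property, such that their topological sum does not have the $\mathcal{AF}$-property.
   Context: For a metrizable space $X$, a continuous map $f\colon X\to X$ and a point $x\in X$, the $\alpha$-limit set of $x$ is $\alpha_f(x)=\bigcap_{n\ge 0}\overline{\bigcup_{k\ge n} f^{-k}(x)}$, where $f^{-k}(x)=\{y\in X: f^k(y)=x\}$. A set $A\subseteq X$ is an $\alpha$-limit set in $X$ if $A=\alpha_f(x)$ for some continuous $f\colon X\to X$ and some $x\in X$. A metrizable space $X$ has the $\mathcal{AF}$-property if the $\alpha$-limit sets in $X$ are precisely the closed subsets of $X$ (including $\emptyset$ and $X$). The topological sum is the disjoint union with the disjoint union topology. *)

theory Defs
  imports "HOL-Analysis.Analysis"
begin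

definition preimage_iterate :: "'a topology \<Rightarrow> ('a \<Rightarrow> 'a) \<Rightarrow> nat \<Rightarrow> 'a \<Rightarrow> 'a set" where
  "preimage_iterate X f k x = {y \<in> topspace X. (f ^^ k) y = x}"

definition alpha_limit :: "'a topology \<Rightarrow> ('a \<Rightarrow> 'a) \<Rightarrow> 'a \<Rightarrow> 'a set" where
  "alpha_limit X f x = (\<Inter>n. X closure_of (\<Union>k\<in>{n..}. preimage_iterate X f k x))"

definition is_alpha_limit_set :: "'a topology \<Rightarrow> 'a set \<Rightarrow> bool" where
  "is_alpha_limit_set X A \<longleftrightarrow>
     (\<exists>f. continuous_map X X f \<and> (\<exists>x\<in>topspace X. A = alpha_limit X f x))"

(* Metrizability is not a conjunct here, so that the negation of this property says something
   about alpha-limit sets only; it is to be applied to metrizable spaces. *)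
definition AF_property :: "'a topology \<Rightarrow> bool" where
  "AF_property X \<longleftrightarrow> {A. is_alpha_limit_set X A} = {A. closedin X A}"

(* The library has sums of indexed families; a sum of two spaces is indexed by the booleans. *)
definition binary_sum_topology :: "'a topology \<Rightarrow> 'a topology \<Rightarrow> (bool \<times> 'a) topology" where
  "binary_sum_topology X Y = sum_topology (\<lambda>b. if b then X else Y) UNIV"

end

theory Submission
  imports Defs "HOL-Library.Real_Mod" "HOL-Library.Periodic_Fun"
begin

text \<open>
A spiral is the closure of a ray \<open>u \<mapsto> (cis (h u), 1 / (1 + u))\<close>, \<open>u \<ge> 0\<close>, that winds
towards the circle \<open>circle\<close> at height \<open>0\<close>; the winding function \<open>h\<close> records how it turns. The two
continua are the spiral of the identity, whose ray always turns in the same direction, and the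
spiral of \<open>osc u = u * sin (2 * pi * log 2 u)\<close>, whose ray turns back and forth by unbounded amounts.

Each of them has the AF-property. If some path runs from a point of a closed set \<open>A\<close> to a point
outside \<open>A\<close>, then \<open>A\<close> is an alpha-limit set (\<open>is_alpha_limit_set_if_path_leaves\<close>): follow the path
after its last visit to \<open>A\<close> for a time given by the distance from \<open>A\<close>. Constant maps give the
empty set and the whole space. The ray and the circle are paths and the ray is dense, so
the only other closed set is the circle itself. Both winding functions satisfy
\<open>h (2 * u) = 2 * h u\<close>, so \<open>u \<mapsto> 2 * u\<close> on the ray extends to the angle-doubling map on the
circle, where the backward orbit of a fixed point is dense.

The two spirals are unrelated: a map between them, in either direction, that
sends circle to circle must send everything into the circle. Otherwise it would send ray to ray, by
\<open>u \<mapsto> \<psi> u\<close> with \<open>\<psi> u\<close> tending to infinity, and lifting angles to the reals would give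
\<open>h2 (\<psi> u) = d * h1 u + O(1)\<close> with \<open>d\<close> the degree on the circle
(\<open>unrelated_imp_into_circle\<close>). One of the two winding functions tends to
infinity while the other one swings between arbitrarily large positive and negative values, so
this is impossible.

In the sum, the union of the two circles is closed but not an alpha-limit set. Suppose that it is
the alpha-limit set of \<open>x\<close> under \<open>f\<close>. Alpha-limit sets are forward
invariant, so circles go to circles. Both components contain preimages of \<open>x\<close>, so \<open>f\<close> sends at least
one component to the other one, and hence into a circle; then \<open>f\<close> sends both components into circles
(\<open>all_into_circle\<close>). No point of a ray is in the alpha-limit set, so each compact part
of a ray misses \<open>f\<^sup>-\<^sup>k(x)\<close> for large \<open>k\<close>, and so does its image. Thus each point
in the interior of the arc that is the image of a ray has a neighbourhood in the circle which
\<open>f\<^sup>-\<^sup>k(x)\<close> misses for large \<open>k\<close>. As \<open>f\<^sup>-\<^sup>k(x)\<close> approaches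
every point of the circles, \<open>f\<close> sends no point of a circle into that interior. Only the finitely
many end points of the arc remain, so \<open>f\<close> is constant on each circle
(\<open>g_constant_on_circle\<close>). Then \<open>f \<circ> f\<close> is constant on each component, and the trace of the
alpha-limit set on a component is empty or the whole component, a contradiction.
\<close>

section \<open>Alpha-limit sets in topological spaces\<close>

lemma in_alpha_limit_iff:
  "p \<in> alpha_limit X f x \<longleftrightarrow>
     p \<in> topspace X \<and> (\<forall>U n. openin X U \<and> p \<in> U \<longrightarrow> (\<exists>k\<ge>n. \<exists>y\<in>U. (f ^^ k) y = x))"
  (is "?L \<longleftrightarrow> ?R")
proof
  assume L: ?L
  then have cl: "p \<in> X closure_of (\<Union>k\<in>{n..}. preimage_iterate X f k x)" for n
    by (auto simp: alpha_limit_def)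
  show ?R
  proof (intro conjI allI impI)
    show "p \<in> topspace X"
      using cl[of 0] closure_of_subset_topspace by fastforce
    fix U n
    assume "openin X U \<and> p \<in> U"
    then obtain y where "y \<in> U" "y \<in> (\<Union>k\<in>{n..}. preimage_iterate X f k x)"
      using cl[of n] unfolding in_closure_of by blast
    then show "\<exists>k\<ge>n. \<exists>y\<in>U. (f ^^ k) y = x"
      by (auto simp: preimage_iterate_def)
  qed
next
  assume R: ?R
  have "p \<in> X closure_of (\<Union>k\<in>{n..}. preimage_iterate X f k x)" for n
    unfolding in_closure_of
  proof (intro conjI allI impI)
    show "p \<in> topspace X" using R by blast
    fix U
    assume U: "p \<in> U \<and> openin X U"
    then obtain k y where "k \<ge> n" "y \<in> U" "(f ^^ k) y = x"
      using R by meson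
    moreover from this U have "y \<in> topspace X"
      using openin_subset by blast
    ultimately show "\<exists>y. y \<in> (\<Union>k\<in>{n..}. preimage_iterate X f k x) \<and> y \<in> U"
      by (auto simp: preimage_iterate_def)
  qed
  then show ?L by (auto simp: alpha_limit_def)
qed

lemma closedin_alpha_limit: "closedin X (alpha_limit X f x)"
  unfolding alpha_limit_def by (rule closedin_Inter) auto

lemma alpha_limit_forward_invariant:
  assumes f: "continuous_map X X f" and p: "p \<in> alpha_limit X f x"
  shows "f p \<in> alpha_limit X f x"
  unfolding in_alpha_limit_iff
proof (intro conjI allI impI)
  have pX: "p \<in> topspace X" using p by (simp add: in_alpha_limit_iff)
  then show "f p \<in> topspace X"
    using continuous_map_image_subset_topspace[OF f] by blast
  fix V n
  assume V: "openin X V \<and> f p \<in> V"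
  define U where "U = {y \<in> topspace X. f y \<in> V}"
  have "openin X U" "p \<in> U"
    using V pX f by (auto simp: U_def continuous_map_def)
  then obtain k y where k: "k \<ge> Suc n" and y: "y \<in> U" "(f ^^ k) y = x"
    using p unfolding in_alpha_limit_iff by meson
  obtain m where m: "k = Suc m" using k by (cases k) auto
  show "\<exists>k\<ge>n. \<exists>y\<in>V. (f ^^ k) y = x"
    by (rule exI[of _ m]) (use k m y in \<open>auto simp: U_def funpow_swap1\<close>)
qed

text \<open>A point of a compact set that is not in the alpha-limit set has a neighbourhood without late preimages of
\<open>x\<close>; finitely many such neighbourhoods would cover the compact set.\<close>

lemma alpha_limit_meets_compact:
  assumes K: "compactin X K" and inf: "\<And>n. \<exists>k\<ge>n. \<exists>y\<in>K. (f ^^ k) y = x"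
  shows "K \<inter> alpha_limit X f x \<noteq> {}"
proof
  assume "K \<inter> alpha_limit X f x = {}"
  moreover have KX: "K \<subseteq> topspace X" using K compactin_subset_topspace by blast
  ultimately have "\<forall>p\<in>K. \<exists>U n. openin X U \<and> p \<in> U \<and> (\<forall>k\<ge>n. \<forall>y\<in>U. (f ^^ k) y \<noteq> x)"
    unfolding disjoint_iff in_alpha_limit_iff by (metis subsetD)
  then obtain U n where U: "\<And>p. p \<in> K \<Longrightarrow> openin X (U p) \<and> p \<in> U p"
    and n: "\<And>p k y. \<lbrakk>p \<in> K; k \<ge> n p; y \<in> U p\<rbrakk> \<Longrightarrow> (f ^^ k) y \<noteq> x"
    by metis
  obtain F where F: "finite F" "F \<subseteq> U ` K" "K \<subseteq> \<Union>F"
    using K U unfolding compactin_def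
    by (metis (no_types, lifting) UN_I imageE subsetI)
  then obtain P where P: "finite P" "P \<subseteq> K" "F = U ` P"
    by (meson finite_subset_image)
  obtain N where N: "\<And>p. p \<in> P \<Longrightarrow> n p \<le> N"
    using P(1) by (metis finite_imageI finite_nat_set_iff_bounded_le imageI)
  obtain k y where "k \<ge> N" "y \<in> K" "(f ^^ k) y = x"
    using inf by blast
  moreover obtain p where "p \<in> P" "y \<in> U p"
    using F(3) P(3) \<open>y \<in> K\<close> by blast
  ultimately show False
    using n[of p k y] N[of p] P(2) by auto
qed

text \<open>Here the preimages of \<open>b\<close> of every positive order coincide with \<open>A\<close>.\<close>

lemma alpha_limit_of_collapse:
  assumes A: "closedin X A" and b: "b \<in> A"
    and f: "f \<in> topspace X \<rightarrow> topspace X"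
    and fA: "\<And>y. y \<in> topspace X \<Longrightarrow> f y \<in> A \<longleftrightarrow> y \<in> A" "\<And>y. y \<in> A \<Longrightarrow> f y = b"
  shows "alpha_limit X f b = A"
proof -
  have AX: "A \<subseteq> topspace X" using A closedin_subset by blast
  have iter_X: "y \<in> topspace X \<Longrightarrow> (f ^^ k) y \<in> topspace X" for k y
    by (induction k) (use f in auto)
  have iter: "y \<in> topspace X \<Longrightarrow> (f ^^ k) y \<in> A \<longleftrightarrow> y \<in> A" for k y
    by (induction k) (simp_all add: fA(1)[OF iter_X])
  have iter_b: "y \<in> A \<Longrightarrow> (f ^^ Suc k) y = b" for k y
    using iter[of y k] AX fA(2) by auto
  show ?thesis
  proof (intro equalityI subsetI)
    fix p assume p: "p \<in> alpha_limit X f b"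
    show "p \<in> A"
    proof (rule ccontr)
      assume "p \<notin> A"
      then have "openin X (topspace X - A) \<and> p \<in> topspace X - A"
        using A p by (auto simp: in_alpha_limit_iff)
      then obtain k y where "y \<in> topspace X - A" "(f ^^ k) y = b"
        using p unfolding in_alpha_limit_iff by meson
      then show False using iter[of y k] b by auto
    qed
  next
    fix p assume p: "p \<in> A"
    show "p \<in> alpha_limit X f b"
      unfolding in_alpha_limit_iff
    proof (intro conjI allI impI)
      show "p \<in> topspace X" using p AX by blast
      fix U n
      assume "openin X U \<and> p \<in> U"
      then show "\<exists>k\<ge>n. \<exists>y\<in>U. (f ^^ k) y = b"
        using iter_b[OF p, of n] by (intro exI[of _ "Suc n"]) auto
    qed
  qed
qed

lemma is_alpha_limit_set_topspace:
  assumes "x \<in> topspace X"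
  shows "is_alpha_limit_set X (topspace X)"
proof -
  have "alpha_limit X (\<lambda>_. x) x = topspace X"
    by (rule alpha_limit_of_collapse) (use assms in auto)
  then show ?thesis
    unfolding is_alpha_limit_set_def using assms
    by (intro exI[of _ "\<lambda>_. x"]) auto
qed

lemma is_alpha_limit_set_empty:
  fixes X :: "'a topology"
  assumes "x \<in> topspace X" "y \<in> topspace X" "x \<noteq> y"
  shows "is_alpha_limit_set X {}"
proof -
  have "((\<lambda>_. y) ^^ Suc k) z = y" for k and z :: 'a
    by simp
  then have "((\<lambda>_. y) ^^ k) z \<noteq> x" if "k \<ge> 1" for k and z :: 'a
    using that assms(3) by (metis Suc_le_D One_nat_def)
  then have "alpha_limit X (\<lambda>_. y) x = {}"
    unfolding set_eq_iff in_alpha_limit_iff by (metis empty_iff openin_topspace)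
  then show ?thesis
    unfolding is_alpha_limit_set_def using assms
    by (intro exI[of _ "\<lambda>_. y"]) auto
qed

text \<open>What remains of the path after its last visit to \<open>A\<close> is a path \<open>\<gamma>\<close> that meets \<open>A\<close> only at its start. Composing \<open>\<gamma>\<close>
with the distance from \<open>A\<close> collapses \<open>A\<close> to that start and sends all other points off \<open>A\<close>.\<close>

lemma is_alpha_limit_set_if_path_leaves:
  fixes S :: "'a::metric_space set" and q :: "real \<Rightarrow> 'a"
  assumes A: "closedin (top_of_set S) A"
    and q: "continuous_on {a..b} q" "q ` {a..b} \<subseteq> S" and ab: "a \<le> b"
    and qA: "q a \<in> A" "q b \<notin> A"
  shows "is_alpha_limit_set (top_of_set S) A"
proof -
  have AS: "A \<subseteq> S" using A closedin_imp_subset by blast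
  define B where "B = {t \<in> {a..b}. q t \<in> A}"
  have "closedin (top_of_set {a..b}) ({a..b} \<inter> q -` A)"
    using q A by (intro continuous_closedin_preimage_gen) (auto simp: image_subset_iff_funcset)
  then have "closed B"
    by (metis B_def Collect_mem_eq closed_atLeastAtMost closedin_closed_trans Collect_conj_eq vimage_def)
  then have "compact B"
    using compact_Icc[of a b] by (metis (no_types, lifting) B_def Int_absorb1 compact_Int_closed mem_Collect_eq subsetI)
  moreover have "a \<in> B" using ab qA by (auto simp: B_def)
  ultimately obtain t0 where t0: "t0 \<in> B" "\<And>t. t \<in> B \<Longrightarrow> t \<le> t0"
    using compact_attains_sup[of B] by blast
  have "t0 \<in> {a..b}" "q t0 \<in> A" using t0(1) by (auto simp: B_def)
  with qA(2) have t0b: "t0 < b" by (cases "t0 = b") auto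
  define \<gamma> where "\<gamma> t = q (t0 + (b - t0) * t)" for t
  have arg: "t0 + (b - t0) * t \<in> {t0..b}" if "t \<in> {0..1}" for t
  proof -
    have "0 \<le> (b - t0) * t" "(b - t0) * t \<le> b - t0"
      using that t0b by (auto intro: mult_left_le)
    then show ?thesis by auto
  qed
  have \<gamma>A: "\<gamma> t \<in> A \<longleftrightarrow> t = 0" if "t \<in> {0..1}" for t
  proof
    assume "\<gamma> t \<in> A"
    then have "t0 + (b - t0) * t \<in> B"
      using arg[OF that] \<open>t0 \<in> {a..b}\<close> by (auto simp: B_def \<gamma>_def)
    then have "(b - t0) * t \<le> 0" using t0(2) by fastforce
    then show "t = 0" using that t0b by (auto simp: mult_le_0_iff)
  qed (use \<open>q t0 \<in> A\<close> in \<open>simp add: \<gamma>_def\<close>)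
  have \<gamma>S: "\<gamma> t \<in> S" if "t \<in> {0..1}" for t
    using arg[OF that] \<open>t0 \<in> {a..b}\<close> q(2) by (auto simp: \<gamma>_def)
  have \<gamma>cont: "continuous_on {0..1} \<gamma>"
    unfolding \<gamma>_def
  proof (rule continuous_on_compose2[OF q(1)])
    show "continuous_on {0..1} (\<lambda>t. t0 + (b - t0) * t)" by (intro continuous_intros)
    show "(\<lambda>t. t0 + (b - t0) * t) ` {0..1} \<subseteq> {a..b}"
      using arg \<open>t0 \<in> {a..b}\<close> unfolding image_subset_iff by (meson atLeastAtMost_iff order_trans)
  qed
  define f where "f y = \<gamma> (min 1 (infdist y A))" for y
  have m: "min 1 (infdist y A) \<in> {0..1}" for y
    by (auto simp: infdist_nonneg)
  have "continuous_on S (\<lambda>y. min 1 (infdist y A))"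
    by (intro continuous_intros)
  then have fcont: "continuous_on S f"
    unfolding f_def using m by (intro continuous_on_compose2[OF \<gamma>cont]) auto
  have fS: "f y \<in> S" for y using \<gamma>S m by (simp add: f_def)
  have inf0: "infdist y A = 0 \<longleftrightarrow> y \<in> A" if "y \<in> S" for y
  proof -
    have "A \<noteq> {}" using qA(1) by blast
    obtain T where "closed T" "A = S \<inter> T" using A by (auto simp: closedin_closed)
    then have "y \<in> closure A \<longleftrightarrow> y \<in> A"
      using that closure_minimal[of A T] closure_subset[of A] by auto
    then show ?thesis using in_closure_iff_infdist_zero[OF \<open>A \<noteq> {}\<close>] by auto
  qed
  have fA: "f y \<in> A \<longleftrightarrow> y \<in> A" if "y \<in> S" for y
    unfolding f_def using \<gamma>A[OF m] inf0[OF that] by (auto simp: min_def)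
  have fb: "f y = \<gamma> 0" if "y \<in> A" for y
    using inf0[of y] that AS by (auto simp: f_def)
  have \<gamma>0: "\<gamma> 0 \<in> A" using \<gamma>A[of 0] by auto
  have "alpha_limit (top_of_set S) f (\<gamma> 0) = A"
    by (rule alpha_limit_of_collapse) (use A \<gamma>0 fS fA fb in auto)
  moreover have "continuous_map (top_of_set S) (top_of_set S) f"
    using fcont fS by auto
  ultimately show ?thesis
    unfolding is_alpha_limit_set_def using \<gamma>S[of 0] by (intro exI[of _ f]) auto
qed

section \<open>Invariance under homeomorphism\<close>

lemma is_alpha_limit_set_homeomorphic_image:
  assumes h: "homeomorphic_maps X Y \<phi> \<psi>" and A: "is_alpha_limit_set X A"
  shows "is_alpha_limit_set Y (\<phi> ` A)"
proof -
  obtain f x where f: "continuous_map X X f" and x: "x \<in> topspace X" and Aeq: "A = alpha_limit X f x"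
    using A by (auto simp: is_alpha_limit_set_def)
  have \<phi>: "continuous_map X Y \<phi>" and \<psi>: "continuous_map Y X \<psi>"
    and \<psi>\<phi>: "\<And>p. p \<in> topspace X \<Longrightarrow> \<psi> (\<phi> p) = p" and \<phi>\<psi>: "\<And>q. q \<in> topspace Y \<Longrightarrow> \<phi> (\<psi> q) = q"
    using h by (auto simp: homeomorphic_maps_def)
  have \<phi>Y: "\<And>p. p \<in> topspace X \<Longrightarrow> \<phi> p \<in> topspace Y" and \<psi>X: "\<And>q. q \<in> topspace Y \<Longrightarrow> \<psi> q \<in> topspace X"
    and fX: "\<And>p. p \<in> topspace X \<Longrightarrow> f p \<in> topspace X"
    using \<phi> \<psi> f by (auto simp: continuous_map_def)
  define f' where "f' = \<phi> \<circ> f \<circ> \<psi>"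
  have f': "continuous_map Y Y f'"
    unfolding f'_def by (rule continuous_map_compose[OF \<psi> continuous_map_compose[OF f \<phi>], folded comp_assoc])
  have iterX: "p \<in> topspace X \<Longrightarrow> (f ^^ k) p \<in> topspace X" for k p
    by (induction k) (auto simp: fX)
  have iter: "q \<in> topspace Y \<Longrightarrow> (f' ^^ k) q = \<phi> ((f ^^ k) (\<psi> q))" for k q
    by (induction k) (auto simp: \<phi>\<psi> \<psi>\<phi> iterX \<psi>X f'_def)
  have "alpha_limit Y f' (\<phi> x) = \<phi> ` alpha_limit X f x"
  proof (intro equalityI subsetI)
    fix q assume q: "q \<in> alpha_limit Y f' (\<phi> x)"
    then have qY: "q \<in> topspace Y" by (simp add: in_alpha_limit_iff)
    have "\<psi> q \<in> alpha_limit X f x"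
      unfolding in_alpha_limit_iff
    proof (intro conjI allI impI)
      show "\<psi> q \<in> topspace X" using \<psi>X qY by blast
      fix U n assume U: "openin X U \<and> \<psi> q \<in> U"
      then have "openin Y {y \<in> topspace Y. \<psi> y \<in> U}" "q \<in> {y \<in> topspace Y. \<psi> y \<in> U}"
        using \<psi> qY by (auto simp: continuous_map_def)
      then obtain k y where ky: "k \<ge> n" "y \<in> topspace Y" "\<psi> y \<in> U" "(f' ^^ k) y = \<phi> x"
        using q unfolding in_alpha_limit_iff by (metis (no_types, lifting) mem_Collect_eq)
      then have "(f ^^ k) (\<psi> y) = x"
        using iter[of y k] \<psi>\<phi>[OF x] \<psi>\<phi>[OF iterX[of "\<psi> y" k]] \<psi>X by metis
      with ky show "\<exists>k\<ge>n. \<exists>y\<in>U. (f ^^ k) y = x" by blast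
    qed
    then show "q \<in> \<phi> ` alpha_limit X f x" using \<phi>\<psi>[OF qY] by force
  next
    fix q assume "q \<in> \<phi> ` alpha_limit X f x"
    then obtain p where p: "p \<in> alpha_limit X f x" and q: "q = \<phi> p" by blast
    then have pX: "p \<in> topspace X" by (simp add: in_alpha_limit_iff)
    show "q \<in> alpha_limit Y f' (\<phi> x)"
      unfolding in_alpha_limit_iff
    proof (intro conjI allI impI)
      show "q \<in> topspace Y" using \<phi>Y pX q by blast
      fix V n assume V: "openin Y V \<and> q \<in> V"
      then have "openin X {y \<in> topspace X. \<phi> y \<in> V}" "p \<in> {y \<in> topspace X. \<phi> y \<in> V}"
        using \<phi> pX q by (auto simp: continuous_map_def)
      then obtain k y where ky: "k \<ge> n" "y \<in> topspace X" "\<phi> y \<in> V" "(f ^^ k) y = x"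
        using p unfolding in_alpha_limit_iff by (metis (no_types, lifting) mem_Collect_eq)
      then have "(f' ^^ k) (\<phi> y) = \<phi> x"
        using iter[of "\<phi> y" k] \<psi>\<phi> \<phi>Y by simp
      with ky show "\<exists>k\<ge>n. \<exists>y\<in>V. (f' ^^ k) y = \<phi> x" by blast
    qed
  qed
  then show ?thesis
    unfolding is_alpha_limit_set_def Aeq using f' \<phi>Y[OF x] by metis
qed

lemma AF_property_homeomorphic:
  assumes "X homeomorphic_space Y" and X: "AF_property X"
  shows "AF_property Y"
proof -
  obtain \<phi> \<psi> where h: "homeomorphic_maps X Y \<phi> \<psi>"
    using assms(1) by (auto simp: homeomorphic_space_def)
  have image_back: "\<phi> ` \<psi> ` B = B" if "B \<subseteq> topspace Y" for B
    using h that unfolding homeomorphic_maps_def image_image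
    by (metis (mono_tags, lifting) image_cong image_ident subsetD)
  have h': "homeomorphic_maps Y X \<psi> \<phi>" using h homeomorphic_maps_sym by blast
  show ?thesis
    unfolding AF_property_def
  proof (intro equalityI subsetI CollectI)
    fix B assume "B \<in> {A. is_alpha_limit_set Y A}"
    then show "closedin Y B" by (auto simp: is_alpha_limit_set_def closedin_alpha_limit)
  next
    fix B assume "B \<in> {A. closedin Y A}"
    then have B: "closedin Y B" by simp
    then have "closedin X (\<psi> ` B)"
      using homeomorphic_imp_closed_map[of Y X \<psi>] h' homeomorphic_maps_map[of Y X \<psi> \<phi>]
      by (auto simp: closed_map_def)
    then have "is_alpha_limit_set X (\<psi> ` B)"
      using X by (auto simp: AF_property_def)
    then show "is_alpha_limit_set Y B"
      using is_alpha_limit_set_homeomorphic_image[OF h] image_back[OF closedin_subset[OF B]] by metis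
  qed
qed

lemma sum_topology_homeomorphic:
  assumes "\<And>i. i \<in> I \<Longrightarrow> X i homeomorphic_space Y i"
  shows "sum_topology X I homeomorphic_space sum_topology Y I"
proof -
  obtain \<phi> \<psi> where h: "\<And>i. i \<in> I \<Longrightarrow> homeomorphic_maps (X i) (Y i) (\<phi> i) (\<psi> i)"
    using assms unfolding homeomorphic_space_def by metis
  have cont: "continuous_map (sum_topology X I) (sum_topology Y I) (\<lambda>(i, p). (i, \<phi> i p))"
    if "\<And>i. i \<in> I \<Longrightarrow> continuous_map (X i) (Y i) (\<phi> i)"
    for X :: "_ \<Rightarrow> 'x topology" and Y :: "_ \<Rightarrow> 'y topology" and \<phi>
  proof -
    have "openin (X i) {p. p \<in> topspace (X i) \<and> (i, \<phi> i p) \<in> U}"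
      if "i \<in> I" "openin (sum_topology Y I) U" for i U
    proof -
      have "openin (Y i) {q. (i, q) \<in> U}"
        using that by (simp add: openin_sum_topology)
      then show ?thesis
        using \<open>i \<in> I\<close> \<open>\<And>i. i \<in> I \<Longrightarrow> continuous_map (X i) (Y i) (\<phi> i)\<close>[of i]
        by (auto simp: continuous_map_def)
    qed
    then show ?thesis
      using that by (auto simp: continuous_map_def openin_sum_topology[of X] conj_ac Pi_iff)
  qed
  have "homeomorphic_maps (sum_topology X I) (sum_topology Y I) (\<lambda>(i, p). (i, \<phi> i p)) (\<lambda>(i, p). (i, \<psi> i p))"
    unfolding homeomorphic_maps_def using h
    by (intro conjI cont) (auto simp: homeomorphic_maps_def)
  then show ?thesis unfolding homeomorphic_space_def by blast
qed

section \<open>Lifting maps into the circle\<close>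

lemma circle_lift:
  fixes F :: "real \<Rightarrow> complex"
  assumes F: "continuous_on S F" "\<And>t. t \<in> S \<Longrightarrow> norm (F t) = 1" and S: "convex S"
  obtains G where "continuous_on S G" "\<And>t. t \<in> S \<Longrightarrow> F t = cis (G t)"
proof -
  have "F t \<noteq> 0" if "t \<in> S" for t using F(2)[OF that] by auto
  then obtain g where g: "continuous_on S g" "\<And>t. t \<in> S \<Longrightarrow> F t = exp (g t)"
    using continuous_logarithm_on_contractible[OF F(1) convex_imp_contractible[OF S]] by metis
  show ?thesis
  proof
    show "continuous_on S (\<lambda>t. Im (g t))" by (intro continuous_intros g(1))
    fix t assume t: "t \<in> S"
    then have "exp (Re (g t)) = 1"
      using F(2)[OF t] g(2)[OF t] by (simp add: norm_exp_eq_Re)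
    then show "F t = cis (Im (g t))" using g(2)[OF t] by (simp add: exp_eq_polar)
  qed
qed

lemma cis_eq_imp_constant_difference:
  fixes a b :: "real \<Rightarrow> real"
  assumes S: "connected S" and a: "continuous_on S a" and b: "continuous_on S b"
    and eq: "\<And>t. t \<in> S \<Longrightarrow> cis (a t) = cis (b t)"
  obtains K where "\<And>t. t \<in> S \<Longrightarrow> a t = b t + K"
proof -
  have mult: "\<exists>n. a t - b t = of_int n * (2 * pi)" if "t \<in> S" for t
    using eq[OF that] cis_divide[of "a t" "b t"] by (simp add: cis_eq_1_iff)
  have "(\<lambda>t. a t - b t) constant_on S"
  proof (rule continuous_discrete_range_constant[OF S])
    show "continuous_on S (\<lambda>t. a t - b t)" by (intro continuous_intros a b)
    fix t assume t: "t \<in> S"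
    have "2 * pi \<le> norm (a y - b y - (a t - b t))" if y: "y \<in> S" "a y - b y \<noteq> a t - b t" for y
    proof -
      obtain n m where nm: "a t - b t = of_int n * (2 * pi)" "a y - b y = of_int m * (2 * pi)"
        using mult t y(1) by metis
      then have "m \<noteq> n" using y(2) by auto
      then have "1 \<le> \<bar>real_of_int (m - n)\<bar>" by linarith
      then have "1 * (2 * pi) \<le> \<bar>real_of_int (m - n)\<bar> * (2 * pi)"
        by (intro mult_right_mono) auto
      then show ?thesis by (simp add: nm abs_mult flip: left_diff_distrib)
    qed
    then show "\<exists>e>0. \<forall>y. y \<in> S \<and> a y - b y \<noteq> a t - b t \<longrightarrow> e \<le> norm (a y - b y - (a t - b t))"
      by (intro exI[of _ "2 * pi"]) auto
  qed
  then obtain K where "\<And>t. t \<in> S \<Longrightarrow> a t - b t = K" by (auto simp: constant_on_def)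
  then show ?thesis using that[of K] by force
qed

section \<open>Spirals onto a circle\<close>

text \<open>The circle and the ray live in \<open>complex \<times> real\<close>: the first component is the direction, the second
is the height above the circle. Recovering \<open>u\<close> from the height \<open>s\<close> as \<open>1 / s - 1\<close> turns statements on
the ray into statements on continuous real functions.\<close>

definition circ :: "real \<Rightarrow> complex \<times> real"
  where "circ \<theta> = (cis \<theta>, 0)"

definition circle :: "(complex \<times> real) set"
  where "circle = range circ"

definition ray :: "(real \<Rightarrow> real) \<Rightarrow> real \<Rightarrow> complex \<times> real"
  where "ray h u = (cis (h u), 1 / (1 + u))"

definition spiral :: "(real \<Rightarrow> real) \<Rightarrow> (complex \<times> real) set"
  where "spiral h = ray h ` {0..} \<union> circle"

lemma circ_in_circle [simp]: "circ \<theta> \<in> circle"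
  by (simp add: circle_def)

lemma circle_subset_spiral: "circle \<subseteq> spiral h"
  by (simp add: spiral_def)

lemma ray_in_spiral [simp]: "u \<ge> 0 \<Longrightarrow> ray h u \<in> spiral h"
  by (simp add: spiral_def)

lemma snd_ray_pos [simp]: "u \<ge> 0 \<Longrightarrow> snd (ray h u) > 0"
  by (simp add: ray_def)

lemma fst_ray [simp]: "fst (ray h u) = cis (h u)"
  by (simp add: ray_def)

lemma spiral_snd_nonneg: "p \<in> spiral h \<Longrightarrow> snd p \<ge> 0"
  by (auto simp: spiral_def circle_def circ_def ray_def)

lemma spiral_norm_fst: "p \<in> spiral h \<Longrightarrow> norm (fst p) = 1"
  by (auto simp: spiral_def circle_def circ_def ray_def)

lemma spiral_snd_le_1: "p \<in> spiral h \<Longrightarrow> snd p \<le> 1"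
  by (auto simp: spiral_def circle_def circ_def ray_def)

lemma in_circle_iff: "p \<in> circle \<longleftrightarrow> norm (fst p) = 1 \<and> snd p = 0"
proof
  assume R: "norm (fst p) = 1 \<and> snd p = 0"
  then have "p = circ (Arg (fst p))"
    using rcis_cmod_Arg[of "fst p"] by (cases p) (auto simp: circ_def rcis_def)
  then show "p \<in> circle" by (metis circ_in_circle)
qed (auto simp: circle_def circ_def)

lemma spiral_in_circle_iff: "p \<in> spiral h \<Longrightarrow> p \<in> circle \<longleftrightarrow> snd p = 0"
  by (simp add: in_circle_iff spiral_norm_fst)

lemma spiral_pos_eq_ray:
  assumes "p \<in> spiral h" "snd p > 0"
  shows "0 \<le> 1 / snd p - 1" "p = ray h (1 / snd p - 1)"
proof -
  have "p \<notin> circle" using assms(2) in_circle_iff by auto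
  then obtain u where u: "u \<ge> 0" "p = ray h u" using assms(1) by (auto simp: spiral_def)
  then have "1 / snd p - 1 = u" by (simp add: ray_def)
  then show "0 \<le> 1 / snd p - 1" "p = ray h (1 / snd p - 1)" using u by simp_all
qed

lemma continuous_on_circ: "continuous_on S circ"
  unfolding circ_def by (intro continuous_intros)

lemma closed_circle: "closed circle"
proof -
  have "circle = sphere 0 1 \<times> {0}"
    by (auto simp: in_circle_iff)
  then show ?thesis
    by (metis closed_Times closed_singleton closed_sphere)
qed

lemma connected_circle: "connected circle"
  unfolding circle_def by (intro connected_continuous_image continuous_on_circ connected_UNIV)

lemma dist_ray_circ: "u \<ge> 0 \<Longrightarrow> dist (ray h u) (circ (h u)) = 1 / (1 + u)"
  by (simp add: ray_def circ_def dist_Pair_Pair)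

text \<open>Unboundedness above makes the ray pass over every angle arbitrarily late, so that the whole circle lies
in its closure. The doubling law provides the self-map whose alpha-limit set is the circle.\<close>

locale winding =
  fixes h :: "real \<Rightarrow> real"
  assumes cont: "continuous_on {0..} h"
    and doubling: "u \<ge> 0 \<Longrightarrow> h (2 * u) = 2 * h u"
    and unbounded: "\<exists>u\<ge>N. M \<le> h u"
begin

lemma continuous_on_ray: "continuous_on {0..} (ray h)"
  unfolding ray_def by (intro continuous_intros cont) auto

lemma ray_reaches_angle:
  assumes "N \<ge> 0"
  obtains u where "u \<ge> N" "cis (h u) = cis \<theta>"
proof -
  define n where "n = \<lceil>(h N - \<theta>) / (2 * pi)\<rceil>"
  have "(h N - \<theta>) / (2 * pi) \<le> n" by (simp add: n_def)
  then have 1: "h N \<le> \<theta> + n * (2 * pi)" by (simp add: field_simps)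
  obtain v where v: "v \<ge> N" "\<theta> + n * (2 * pi) \<le> h v" using unbounded by blast
  have "continuous_on {N..v} h" using cont assms by (rule_tac continuous_on_subset) auto
  then obtain u where u: "N \<le> u" "h u = \<theta> + n * (2 * pi)"
    using IVT'[of h N "\<theta> + n * (2 * pi)" v] 1 v by auto
  have "cis (h u) = cis \<theta>"
    unfolding u(2) cis_mult[symmetric] using cis_multiple_2pi[of "of_int n"] by (simp add: mult.commute)
  with u(1) that show ?thesis by blast
qed

lemma circle_approached_by_ray:
  assumes "p \<in> circle" "e > 0" "N \<ge> 0"
  obtains u where "u \<ge> N" "dist (ray h u) p < e"
proof -
  obtain \<theta> where \<theta>: "p = circ \<theta>" using assms(1) by (auto simp: circle_def)
  obtain u where u: "u \<ge> max N (1 / e)" "cis (h u) = cis \<theta>"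
    using ray_reaches_angle[of "max N (1 / e)"] assms by (auto simp: le_max_iff_disj)
  have "dist (ray h u) p = 1 / (1 + u)"
    using dist_ray_circ[of u h] u assms by (simp add: \<theta> circ_def)
  also have "\<dots> < e" using u(1) assms(2,3) by (simp add: field_simps)
  finally show ?thesis using that[of u] u by auto
qed

lemma spiral_eq_closure: "spiral h = closure (ray h ` {0..})"
proof
  show "spiral h \<subseteq> closure (ray h ` {0..})"
  proof
    fix p assume "p \<in> spiral h"
    then consider "p \<in> ray h ` {0..}" | "p \<in> circle" by (auto simp: spiral_def)
    then show "p \<in> closure (ray h ` {0..})"
    proof cases
      case 2
      show ?thesis
        unfolding closure_approachable
        using circle_approached_by_ray[OF 2, of _ 0] by (metis atLeast_iff imageI order_refl)
    qed (use closure_subset[of "ray h ` {0..}"] in blast)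
  qed
  show "closure (ray h ` {0..}) \<subseteq> spiral h"
  proof
    fix p assume p: "p \<in> closure (ray h ` {0..})"
    have "closure (ray h ` {0..}) \<subseteq> sphere 0 1 \<times> {0..}"
    proof (rule closure_minimal)
      show "ray h ` {0..} \<subseteq> sphere 0 1 \<times> {0..}"
        by (rule image_subsetI) (simp add: ray_def)
      show "closed (sphere (0::complex) 1 \<times> {0::real..})"
        by (rule closed_Times[OF closed_sphere closed_atLeast])
    qed
    then have "p \<in> sphere 0 1 \<times> {0..}" using p by blast
    then have np: "norm (fst p) = 1" "snd p \<ge> 0" by (simp_all add: mem_Times_iff)
    show "p \<in> spiral h"
    proof (cases "snd p = 0")
      case True
      then show ?thesis using np circle_subset_spiral in_circle_iff by blast
    next
      case False
      define N where "N = 1 / snd p"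
      have N: "N > 0" using False np by (simp add: N_def)
      have "ray h ` {0..} = ray h ` {0..N} \<union> ray h ` {N..}"
      proof -
        have "{0..} = {0..N} \<union> {N..}" using N by auto
        then show ?thesis by (simp only: image_Un)
      qed
      then have "p \<in> closure (ray h ` {0..N}) \<union> closure (ray h ` {N..})"
        using p closure_Un by metis
      moreover have "closure (ray h ` {N..}) \<subseteq> UNIV \<times> {..1 / (1 + N)}"
      proof (rule closure_minimal)
        show "ray h ` {N..} \<subseteq> UNIV \<times> {..1 / (1 + N)}"
          by (rule image_subsetI) (use N in \<open>simp add: ray_def frac_le\<close>)
        show "closed ((UNIV :: complex set) \<times> {..1 / (1 + N)})"
          by (rule closed_Times[OF closed_UNIV closed_atMost])
      qed
      moreover have "1 / (1 + N) < snd p"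
        using False np by (simp add: N_def field_simps)
      ultimately have "p \<in> closure (ray h ` {0..N})" by fastforce
      moreover have "compact (ray h ` {0..N})"
        by (intro compact_continuous_image compact_Icc continuous_on_subset[OF continuous_on_ray]) auto
      ultimately have "p \<in> ray h ` {0..N}"
        by (simp add: compact_imp_closed)
      then show ?thesis by auto
    qed
  qed
qed

lemma compact_spiral: "compact (spiral h)"
proof -
  have "spiral h \<subseteq> sphere 0 1 \<times> {0..1}"
    using spiral_norm_fst spiral_snd_nonneg spiral_snd_le_1
    by (intro subsetI) (simp add: mem_Times_iff)
  then have "bounded (spiral h)"
    using bounded_subset[OF bounded_Times[OF bounded_sphere bounded_closed_interval]] by blast
  then show ?thesis by (simp add: compact_eq_bounded_closed spiral_eq_closure)
qed

lemma connected_spiral: "connected (spiral h)"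
  unfolding spiral_eq_closure
  by (intro connected_imp_connected_closure connected_continuous_image continuous_on_ray) auto

section \<open>Liftings along the ray of a spiral\<close>

text \<open>Along a path over the ray, the winding function of the current ray parameter is itself a lift of the direction,
and two lifts differ by a constant.\<close>

lemma lift_on_ray:
  fixes S :: "real set"
  assumes S: "convex S" and p: "continuous_on S p" "p ` S \<subseteq> spiral h"
    and pos: "\<And>t. t \<in> S \<Longrightarrow> snd (p t) > 0"
    and G: "continuous_on S G" "\<And>t. t \<in> S \<Longrightarrow> fst (p t) = cis (G t)"
  obtains K where "\<And>t. t \<in> S \<Longrightarrow> h (1 / snd (p t) - 1) = G t + K"
proof (rule cis_eq_imp_constant_difference[of S "\<lambda>t. h (1 / snd (p t) - 1)" G])
  show "connected S" using S convex_connected by blast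
  have eq: "p t = ray h (1 / snd (p t) - 1)" "0 \<le> 1 / snd (p t) - 1" if "t \<in> S" for t
    using spiral_pos_eq_ray[of "p t" h] p(2) pos that by auto
  show "continuous_on S (\<lambda>t. h (1 / snd (p t) - 1))"
  proof (rule continuous_on_compose2[OF cont])
    show "continuous_on S (\<lambda>t. 1 / snd (p t) - 1)"
      by (intro continuous_intros p(1)) (use pos in force)
  qed (use eq in auto)
  show "cis (h (1 / snd (p t) - 1)) = cis (G t)" if "t \<in> S" for t
    using arg_cong[OF eq(1)[OF that], of fst] G(2)[OF that] by simp
qed (use G that in auto)

text \<open>A path that runs down the ray to the circle in finite time would pass every late ray parameter. Then its
lifted direction, which is bounded on a compact interval, would follow the unbounded \<open>h\<close>.\<close>

lemma no_path_from_ray_to_circle: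
  fixes a b :: real
  assumes p: "continuous_on {a..b} p" "p ` {a..b} \<subseteq> spiral h" and ab: "a \<le> b"
    and pos: "snd (p a) > 0"
  shows "snd (p b) > 0"
proof (rule ccontr)
  assume "\<not> snd (p b) > 0"
  then have b0: "snd (p b) = 0" using spiral_snd_nonneg[of "p b" h] p(2) ab by force
  define B where "B = {t \<in> {a..b}. snd (p t) = 0}"
  have "closedin (top_of_set {a..b}) B"
    unfolding B_def by (intro continuous_closedin_preimage_constant continuous_intros p)
  then have "compact B" using closedin_compact compact_Icc by blast
  moreover have "b \<in> B" using ab b0 by (simp add: B_def)
  ultimately obtain c where c: "c \<in> B" "\<And>t. t \<in> B \<Longrightarrow> c \<le> t"
    using compact_attains_inf[of B] by blast
  then have cab: "a \<le> c" "c \<le> b" and c0: "snd (p c) = 0" by (auto simp: B_def)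
  have cpos: "snd (p t) > 0" if "t \<in> {a..<c}" for t
  proof -
    have "t \<notin> B" using c(2)[of t] that by auto
    then have "snd (p t) \<noteq> 0" using that cab by (auto simp: B_def)
    moreover have "p t \<in> spiral h" using p(2) that cab by auto
    ultimately show ?thesis using spiral_snd_nonneg[of "p t" h] by simp
  qed
  have "continuous_on {a..b} (\<lambda>t. fst (p t))" by (intro continuous_intros p)
  moreover have "norm (fst (p t)) = 1" if "t \<in> {a..b}" for t
    using spiral_norm_fst[of "p t" h] p(2) that by blast
  ultimately obtain G where G: "continuous_on {a..b} G" "\<And>t. t \<in> {a..b} \<Longrightarrow> fst (p t) = cis (G t)"
    using circle_lift[of "{a..b}" "\<lambda>t. fst (p t)"] by auto
  have "bounded (G ` {a..b})"
    by (intro compact_imp_bounded compact_continuous_image G compact_Icc)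
  then obtain M where M: "\<And>t. t \<in> {a..b} \<Longrightarrow> \<bar>G t\<bar> \<le> M" unfolding bounded_iff by (metis image_eqI real_norm_def)
  have sub: "{a..<c} \<subseteq> {a..b}" using cab by auto
  obtain K where K: "\<And>t. t \<in> {a..<c} \<Longrightarrow> h (1 / snd (p t) - 1) = G t + K"
  proof (rule lift_on_ray[of "{a..<c}" p G])
    show "continuous_on {a..<c} p" "continuous_on {a..<c} G"
      using p(1) G(1) sub continuous_on_subset by blast+
    show "p ` {a..<c} \<subseteq> spiral h" using p(2) sub by blast
  qed (use cpos G(2) sub in auto)
  obtain v where v: "v \<ge> 1 / snd (p a) - 1" "M + K + 1 \<le> h v" using unbounded by blast
  have v1: "1 + v > 0" using v(1) pos by (smt (verit) divide_pos_pos)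
  have "1 / (1 + v) \<le> snd (p a)" using v(1) v1 pos by (simp add: field_simps)
  moreover have "continuous_on {a..c} (\<lambda>t. snd (p t))"
    by (intro continuous_intros continuous_on_subset[OF p(1)]) (use cab in auto)
  ultimately obtain t where t: "a \<le> t" "t \<le> c" "snd (p t) = 1 / (1 + v)"
    using IVT2'[of "\<lambda>t. snd (p t)" c "1 / (1 + v)" a] cab c0 v1 by auto
  then have "t \<noteq> c" using c0 v1 by auto
  then have tc: "t \<in> {a..<c}" using t by auto
  have "h v = G t + K" using K[OF tc] t(3) v1 by simp
  moreover have "G t \<le> M" using M[of t] tc cab by auto
  ultimately show False using v(2) by simp
qed

text \<open>Far out the ray is close to the circle, so a lift of \<open>F\<close> along the ray stays close, modulo \<open>2 * pi\<close>, to a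
lift of \<open>F\<close> along the circle evaluated at \<open>h u\<close>; and the latter is linear up to a bounded periodic term,
with slope the degree \<open>d\<close>.\<close>

lemma lift_bounded_by_degree:
  fixes F :: "complex \<times> real \<Rightarrow> complex"
  assumes F: "continuous_on (spiral h) F" "\<And>p. p \<in> spiral h \<Longrightarrow> norm (F p) = 1"
    and G: "continuous_on {0..} G" "\<And>u. u \<ge> 0 \<Longrightarrow> F (ray h u) = cis (G u)"
  obtains d B where "\<And>u. u \<ge> 0 \<Longrightarrow> \<bar>G u - d * h u\<bar> \<le> B"
proof -
  have circS: "circ \<theta> \<in> spiral h" for \<theta> using circle_subset_spiral circ_in_circle by blast
  have "continuous_on UNIV (\<lambda>\<theta>. F (circ \<theta>))"
    by (rule continuous_on_compose2[OF F(1) continuous_on_circ]) (use circS in auto)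
  then obtain H where H: "continuous_on UNIV H" "\<And>\<theta>. F (circ \<theta>) = cis (H \<theta>)"
    using circle_lift[of UNIV "\<lambda>\<theta>. F (circ \<theta>)"] F(2)[OF circS] by auto
  have Hc: "continuous_on S (\<lambda>t. H (a t))" if "continuous_on S a" for S :: "real set" and a
    using continuous_on_compose2[OF H(1) that] by auto
  obtain D where D: "\<And>\<theta>. H (\<theta> + 2 * pi) = H \<theta> + D"
  proof (rule cis_eq_imp_constant_difference[of UNIV "\<lambda>\<theta>. H (\<theta> + 2 * pi)" H])
    have "circ (\<theta> + 2 * pi) = circ \<theta>" for \<theta>
      by (simp add: circ_def cis_mult[symmetric])
    then show "cis (H (\<theta> + 2 * pi)) = cis (H \<theta>)" for \<theta>
      using H(2) by metis
  qed (use H(1) in \<open>auto intro!: Hc continuous_intros\<close>)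
  define d where "d = D / (2 * pi)"
  define P where "P \<theta> = H \<theta> - d * \<theta>" for \<theta>
  \<comment> \<open>\<open>d\<close> is the degree of \<open>F\<close> on the circle, so subtracting \<open>d * \<theta>\<close> makes the lift periodic.\<close>
  interpret P: periodic_fun_simple P "2 * pi"
  proof
    fix \<theta>
    show "P (\<theta> + 2 * pi) = P \<theta>" unfolding P_def D d_def distrib_left by simp
  qed
  have "compact (P ` {0..2 * pi})"
  proof (rule compact_continuous_image)
    have "continuous_on {0..2 * pi} H" using H(1) continuous_on_subset by blast
    then show "continuous_on {0..2 * pi} P"
      unfolding P_def by (intro continuous_intros)
  qed simp
  then obtain B1 where B1: "\<And>\<theta>. \<theta> \<in> {0..2 * pi} \<Longrightarrow> \<bar>P \<theta>\<bar> \<le> B1"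
    using compact_imp_bounded[of "P ` {0..2 * pi}"] unfolding bounded_iff by (metis image_eqI real_norm_def)
  have PB: "\<bar>P \<theta>\<bar> \<le> B1" for \<theta>
  proof -
    define n where "n = \<lfloor>\<theta> / (2 * pi)\<rfloor>"
    have "of_int n \<le> \<theta> / (2 * pi)" "\<theta> / (2 * pi) < of_int n + 1" by (auto simp: n_def)
    then have "\<theta> - of_int n * (2 * pi) \<in> {0..2 * pi}" by (simp add: field_simps)
    then show ?thesis using B1 P.minus_of_int[of \<theta> n] by metis
  qed
  have "uniformly_continuous_on (spiral h) F"
    by (rule compact_uniformly_continuous[OF F(1) compact_spiral])
  then obtain \<delta> where \<delta>: "\<delta> > 0"
    "\<And>p q. \<lbrakk>p \<in> spiral h; q \<in> spiral h; dist q p < \<delta>\<rbrakk> \<Longrightarrow> dist (F q) (F p) < 1"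
    unfolding uniformly_continuous_on_def by (metis zero_less_one)
  define a where "a = 1 / \<delta>"
  have a0: "a > 0" using \<delta> by (simp add: a_def)
  define E where "E u = G u - H (h u)" for u
  have Econt: "continuous_on {0..} E"
    unfolding E_def by (intro continuous_intros G Hc cont)
  \<comment> \<open>The two lifts agree up to an error \<open>E\<close>, which is within \<open>pi / 2\<close> of a multiple of \<open>2 * pi\<close>; being
    continuous, it cannot change to another multiple.\<close>
  have Ecos: "cos (E u) > 0" if "u \<ge> a" for u
  proof -
    have "u \<ge> 0" using that a0 by simp
    have "1 \<le> u * \<delta>" using that \<delta>(1) by (simp add: a_def field_simps)
    then have "1 < (1 + u) * \<delta>" using \<delta>(1) by (simp add: distrib_right)
    then have "1 / (1 + u) < \<delta>" using \<open>u \<ge> 0\<close> by (simp add: pos_divide_less_eq mult.commute)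
    then have "dist (cis (G u)) (cis (H (h u))) < 1"
      using \<delta>(2)[OF circS[of "h u"] ray_in_spiral[of u]] dist_ray_circ[of u h] \<open>u \<ge> 0\<close> G(2)[of u] H(2) by auto
    moreover have "cis (G u) - cis (H (h u)) = cis (H (h u)) * (cis (E u) - 1)"
      by (simp add: E_def algebra_simps cis_mult)
    ultimately have "norm (cis (E u) - 1) < 1" by (simp add: dist_norm norm_mult)
    moreover have "1 - cos (E u) \<le> norm (cis (E u) - 1)"
      using abs_Re_le_cmod[of "cis (E u) - 1"] by simp
    ultimately show ?thesis by simp
  qed
  have conn: "connected (E ` {a..})"
    by (intro connected_continuous_image continuous_on_subset[OF Econt]) (use a0 in auto)
  have narrow: "y < x + pi" if "x \<in> E ` {a..}" "y \<in> E ` {a..}" for x y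
  proof (rule ccontr)
    assume "\<not> y < x + pi"
    then have "x + pi \<in> E ` {a..}"
      using connected_contains_Icc[OF conn that] by force
    then have "cos (x + pi) > 0" "cos x > 0" using Ecos that(1) by force+
    then show False by simp
  qed
  have "compact (E ` {0..a})"
    by (intro compact_continuous_image continuous_on_subset[OF Econt]) auto
  then obtain B2 where B2: "\<And>u. u \<in> {0..a} \<Longrightarrow> \<bar>E u\<bar> \<le> B2"
    using compact_imp_bounded[of "E ` {0..a}"] unfolding bounded_iff by (metis image_eqI real_norm_def)
  have EB: "\<bar>E u\<bar> \<le> B2 + pi" if "u \<ge> 0" for u
  proof (cases "u \<le> a")
    case True
    then show ?thesis using B2[of u] that pi_ge_zero by (simp add: add_increasing2)
  next
    case False
    then have "E u < E a + pi" "E a < E u + pi" by (auto intro!: narrow)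
    then show ?thesis using B2[of a] a0 by (simp add: abs_le_iff)
  qed
  show ?thesis
  proof
    fix u :: real assume "u \<ge> 0"
    have "G u - d * h u = E u + P (h u)" by (simp add: E_def P_def)
    then show "\<bar>G u - d * h u\<bar> \<le> B2 + pi + B1"
      using EB[OF \<open>u \<ge> 0\<close>] PB[of "h u"] by linarith
  qed
qed

end

section \<open>Maps between spirals\<close>

text \<open>This excludes every relation \<open>h2 (\<psi> u) = d * h1 u + O(1)\<close> that a map from ray to ray of degree \<open>d\<close> on the
circle would force.\<close>

definition unrelated :: "(real \<Rightarrow> real) \<Rightarrow> (real \<Rightarrow> real) \<Rightarrow> bool" where
  "unrelated h1 h2 \<longleftrightarrow>
     (\<forall>\<psi> d B. continuous_on {0..} \<psi> \<and> filterlim \<psi> at_top at_top \<longrightarrow>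
        (\<exists>u\<ge>0. \<bar>h2 (\<psi> u) - d * h1 u\<bar> > B))"

locale spiral_map = W1: winding h1 + W2: winding h2 for h1 h2 +
  fixes g :: "complex \<times> real \<Rightarrow> complex \<times> real"
  assumes gcont: "continuous_on (spiral h1) g"
    and gspiral: "g ` spiral h1 \<subseteq> spiral h2"
    and gcircle: "g ` circle \<subseteq> circle"
begin

text \<open>The image of the ray is path connected, and no path joins the ray to the circle.\<close>

lemma ray_pos_dichotomy:
  assumes "u \<ge> 0" "snd (g (ray h1 u)) > 0" "v \<ge> 0"
  shows "snd (g (ray h1 v)) > 0"
proof (cases "u \<le> v")
  case True
  show ?thesis
  proof (rule W2.no_path_from_ray_to_circle[of u v "\<lambda>t. g (ray h1 t)"])
    show "continuous_on {u..v} (\<lambda>t. g (ray h1 t))"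
      by (rule continuous_on_compose2[OF gcont continuous_on_subset[OF W1.continuous_on_ray]])
         (use assms in auto)
  qed (use assms True gspiral in auto)
next
  case False
  have "snd (g (ray h1 (- (- v)))) > 0"
  proof (rule W2.no_path_from_ray_to_circle[of "- u" "- v" "\<lambda>t. g (ray h1 (- t))"])
    have "continuous_on {- u..- v} (\<lambda>t. ray h1 (- t))"
      by (rule continuous_on_compose2[OF W1.continuous_on_ray])
         (use assms in \<open>auto intro!: continuous_intros\<close>)
    then show "continuous_on {- u..- v} (\<lambda>t. g (ray h1 (- t)))"
      by (rule continuous_on_compose2[OF gcont]) (use assms in auto)
  qed (use assms False gspiral in auto)
  then show ?thesis by simp
qed

lemma image_cases:
  obtains "g ` spiral h1 \<subseteq> circle" | "\<And>u. u \<ge> 0 \<Longrightarrow> snd (g (ray h1 u)) > 0"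
proof (cases "\<exists>u\<ge>0. snd (g (ray h1 u)) > 0")
  case True
  then show ?thesis using that(2) ray_pos_dichotomy by metis
next
  case False
  have "g (ray h1 u) \<in> circle" if "u \<ge> 0" for u
  proof -
    have "g (ray h1 u) \<in> spiral h2" using gspiral that by auto
    moreover have "snd (g (ray h1 u)) \<le> 0" using False that not_less by blast
    ultimately show ?thesis
      using spiral_snd_nonneg spiral_in_circle_iff by (metis order_antisym)
  qed
  then show ?thesis using that(1) gcircle by (auto simp: spiral_def)
qed

lemma lift_exists:
  obtains G d B where "continuous_on {0..} G" "\<And>u. u \<ge> 0 \<Longrightarrow> fst (g (ray h1 u)) = cis (G u)"
    "\<And>u. u \<ge> 0 \<Longrightarrow> \<bar>G u - d * h1 u\<bar> \<le> B"
proof -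
  have c: "continuous_on (spiral h1) (\<lambda>p. fst (g p))" by (intro continuous_intros gcont)
  have n: "norm (fst (g p)) = 1" if "p \<in> spiral h1" for p
    using gspiral that spiral_norm_fst by blast
  have "continuous_on {0..} (\<lambda>u. fst (g (ray h1 u)))"
    by (rule continuous_on_compose2[OF c W1.continuous_on_ray]) auto
  then obtain G where G: "continuous_on {0..} G" "\<And>u. u \<ge> 0 \<Longrightarrow> fst (g (ray h1 u)) = cis (G u)"
    using circle_lift[of "{0..}" "\<lambda>u. fst (g (ray h1 u))"] n by auto
  then show ?thesis
    using W1.lift_bounded_by_degree[OF c n G] that by metis
qed

text \<open>Otherwise the ray goes to the ray by some \<open>\<psi>\<close>, which tends to infinity because the circle goes to the circle.
Then \<open>h2 (\<psi> u)\<close> and \<open>d * h1 u\<close> are both within bounded distance of a lift of the direction.\<close>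

lemma unrelated_imp_into_circle:
  assumes "unrelated h1 h2"
  shows "g ` spiral h1 \<subseteq> circle"
proof (rule image_cases)
  assume pos: "\<And>u. u \<ge> 0 \<Longrightarrow> snd (g (ray h1 u)) > 0"
  define \<psi> where "\<psi> u = 1 / snd (g (ray h1 u)) - 1" for u
  have gr: "continuous_on {0..} (\<lambda>u. g (ray h1 u))"
    by (rule continuous_on_compose2[OF gcont W1.continuous_on_ray]) auto
  have \<psi>cont: "continuous_on {0..} \<psi>"
    unfolding \<psi>_def by (intro continuous_intros gr) (use pos in force)
  have "uniformly_continuous_on (spiral h1) g"
    by (rule compact_uniformly_continuous[OF gcont W1.compact_spiral])
  have \<psi>lim: "filterlim \<psi> at_top at_top"
    unfolding filterlim_at_top_gt[where c = 0]
  proof (intro allI impI)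
    fix M :: real assume M: "M > 0"
    obtain \<delta> where \<delta>: "\<delta> > 0"
      "\<And>p q. \<lbrakk>p \<in> spiral h1; q \<in> spiral h1; dist q p < \<delta>\<rbrakk> \<Longrightarrow> dist (g q) (g p) < 1 / (1 + M)"
      using \<open>uniformly_continuous_on (spiral h1) g\<close> M
      unfolding uniformly_continuous_on_def by (metis add_pos_pos zero_less_divide_1_iff zero_less_one)
    have "M \<le> \<psi> u" if u: "u \<ge> 1 / \<delta>" for u
    proof -
      have "1 / \<delta> > 0" using \<delta>(1) by simp
      then have u0: "u \<ge> 0" using u by linarith
      have "1 \<le> u * \<delta>" using u \<delta>(1) by (simp add: field_simps)
      then have "1 < (1 + u) * \<delta>" using \<delta>(1) by (simp add: distrib_right)
      then have "1 / (1 + u) < \<delta>" using u0 by (simp add: pos_divide_less_eq mult.commute)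
      moreover have cs: "circ (h1 u) \<in> spiral h1" using circle_subset_spiral circ_in_circle by blast
      ultimately have "dist (g (ray h1 u)) (g (circ (h1 u))) < 1 / (1 + M)"
        using \<delta>(2)[OF cs ray_in_spiral[OF u0]] dist_ray_circ[OF u0, of h1] by simp
      moreover have "snd (g (circ (h1 u))) = 0"
        using gcircle in_circle_iff circ_in_circle by blast
      ultimately have "snd (g (ray h1 u)) < 1 / (1 + M)"
        using dist_snd_le[of "g (ray h1 u)" "g (circ (h1 u))"] by (simp add: dist_real_def)
      then show ?thesis using pos[OF u0] M by (simp add: \<psi>_def field_simps)
    qed
    then show "\<forall>\<^sub>F u in at_top. M \<le> \<psi> u"
      unfolding eventually_at_top_linorder by blast
  qed
  obtain G d B where G: "continuous_on {0..} G" "\<And>u. u \<ge> 0 \<Longrightarrow> fst (g (ray h1 u)) = cis (G u)"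
    "\<And>u. u \<ge> 0 \<Longrightarrow> \<bar>G u - d * h1 u\<bar> \<le> B" using lift_exists by blast
  obtain K where K: "\<And>u. u \<in> {0..} \<Longrightarrow> h2 (\<psi> u) = G u + K"
    unfolding \<psi>_def
    by (rule W2.lift_on_ray[of "{0..}" "\<lambda>u. g (ray h1 u)" G]) (use gr G gspiral pos in auto)
  obtain u where "u \<ge> 0" "\<bar>h2 (\<psi> u) - d * h1 u\<bar> > B + \<bar>K\<bar>"
    using assms \<psi>cont \<psi>lim unfolding unrelated_def by blast
  then show ?thesis using G(3)[of u] K[of u] by auto
qed

end

section \<open>Every closed subset of a spiral is an alpha-limit set\<close>

text \<open>On the ray this is \<open>u \<mapsto> 2 * u\<close>: for \<open>s = 1 / (1 + u)\<close> the height \<open>1 / (1 + 2 * u)\<close> equals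
\<open>s / (2 - s)\<close>, which also makes continuity at the circle evident.\<close>

definition double :: "complex \<times> real \<Rightarrow> complex \<times> real"
  where "double p = ((fst p)\<^sup>2, snd p / (2 - snd p))"

context winding
begin

lemma double_ray: "u \<ge> 0 \<Longrightarrow> double (ray h u) = ray h (2 * u)"
  by (simp add: double_def ray_def doubling Complex.DeMoivre) (simp add: field_simps)

lemma double_circ: "double (circ \<theta>) = circ (2 * \<theta>)"
  by (simp add: double_def circ_def Complex.DeMoivre)

lemma double_in_circle_iff:
  assumes "p \<in> spiral h"
  shows "double p \<in> circle \<longleftrightarrow> p \<in> circle"
proof -
  consider u where "u \<ge> 0" "p = ray h u" | \<theta> where "p = circ \<theta>"
    using assms by (auto simp: spiral_def circle_def)
  then show ?thesis
  proof cases
    case 1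
    then show ?thesis
      using snd_ray_pos[of u h] snd_ray_pos[of "2 * u" h] in_circle_iff
      by (metis double_ray mult_nonneg_nonneg order_less_irrefl zero_le_numeral)
  qed (simp add: double_circ)
qed

lemma double_in_spiral: "p \<in> spiral h \<Longrightarrow> double p \<in> spiral h"
  unfolding spiral_def by (auto simp: double_ray circle_def double_circ)

text \<open>The circle is completely invariant under \<open>double\<close>, and the preimages of the fixed point \<open>circ 0\<close> of order \<open>k\<close>
are the \<open>2 ^ k\<close>-th roots of unity.\<close>

lemma is_alpha_limit_set_circle: "is_alpha_limit_set (top_of_set (spiral h)) circle"
proof -
  have "2 - snd p \<noteq> 0" if "p \<in> spiral h" for p using spiral_snd_le_1[OF that] by linarith
  then have "continuous_on (spiral h) double"
    unfolding double_def by (intro continuous_intros) auto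
  then have cont_double: "continuous_map (top_of_set (spiral h)) (top_of_set (spiral h)) double"
    using double_in_spiral by auto
  have iter_S: "p \<in> spiral h \<Longrightarrow> (double ^^ k) p \<in> spiral h" for k p
    by (induction k) (auto simp: double_in_spiral)
  have iter_circle: "p \<in> spiral h \<Longrightarrow> (double ^^ k) p \<in> circle \<longleftrightarrow> p \<in> circle" for k p
    by (induction k) (simp_all add: double_in_circle_iff[OF iter_S])
  have iter_circ: "(double ^^ k) (circ \<theta>) = circ (2 ^ k * \<theta>)" for k \<theta>
    by (induction k) (simp_all add: double_circ mult.assoc)
  have "alpha_limit (top_of_set (spiral h)) double (circ 0) = circle"
  proof (intro equalityI subsetI)
    fix p assume p: "p \<in> alpha_limit (top_of_set (spiral h)) double (circ 0)"
    show "p \<in> circle"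
    proof (rule ccontr)
      assume "p \<notin> circle"
      moreover have "openin (top_of_set (spiral h)) (spiral h - circle)"
        by (metis closed_circle closed_closedin closedin_closed_Int openin_diff openin_subtopology_self Diff_Int2 Int_commute inf.idem)
      ultimately obtain k y where "y \<in> spiral h - circle" "(double ^^ k) y = circ 0"
        using p unfolding in_alpha_limit_iff by (metis DiffI topspace_euclidean_subtopology)
      then show False using iter_circle[of y k] by auto
    qed
  next
    fix p assume "p \<in> circle"
    then obtain \<theta> where \<theta>: "p = circ \<theta>" by (auto simp: circle_def)
    show "p \<in> alpha_limit (top_of_set (spiral h)) double (circ 0)"
      unfolding in_alpha_limit_iff
    proof (intro conjI allI impI)
      show "p \<in> topspace (top_of_set (spiral h))"
        using \<open>p \<in> circle\<close> circle_subset_spiral by auto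
      fix U n
      assume U: "openin (top_of_set (spiral h)) U \<and> p \<in> U"
      then obtain T where T: "open T" "U = spiral h \<inter> T" by (auto simp: openin_open)
      have "open (circ -` T)"
        by (rule open_vimage[OF T(1) continuous_on_circ])
      then obtain \<delta> where \<delta>: "\<delta> > 0" "ball \<theta> \<delta> \<subseteq> circ -` T"
        using U T(2) \<theta> unfolding open_contains_ball by (metis IntE vimageI)
      obtain m where m: "(1 / 2) ^ m < \<delta> / (2 * pi)"
        using real_arch_pow_inv[of "\<delta> / (2 * pi)" "1 / 2"] \<delta>(1) by auto
      define k where "k = max m n"
      have "(1 / 2 :: real) ^ k \<le> (1 / 2) ^ m" by (intro power_decreasing) (auto simp: k_def)
      then have "(1 / 2) ^ k < \<delta> / (2 * pi)" using m by linarith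
      then have k: "2 * pi / 2 ^ k < \<delta>"
        by (simp add: field_simps power_divide)
      \<comment> \<open>\<open>\<phi>\<close> is the angle of the \<open>2 ^ k\<close>-th root of unity next to \<open>\<theta>\<close>.\<close>
      define j where "j = \<lfloor>\<theta> * 2 ^ k / (2 * pi)\<rfloor>"
      define \<phi> where "\<phi> = of_int j * (2 * pi) / 2 ^ k"
      have "of_int j \<le> \<theta> * 2 ^ k / (2 * pi)" "\<theta> * 2 ^ k / (2 * pi) < of_int j + 1"
        by (auto simp: j_def)
      then have "\<phi> \<le> \<theta>" "\<theta> < \<phi> + 2 * pi / 2 ^ k"
        by (simp_all add: \<phi>_def field_simps)
      then have "\<phi> \<in> ball \<theta> \<delta>" using k by (auto simp: dist_real_def)
      then have "circ \<phi> \<in> U"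
        using \<delta>(2) T(2) circle_subset_spiral[of h] circ_in_circle by blast
      moreover have "(double ^^ k) (circ \<phi>) = circ 0"
        unfolding iter_circ using cis_multiple_2pi[of "of_int j"]
        by (simp add: \<phi>_def circ_def mult.commute)
      ultimately show "\<exists>k\<ge>n. \<exists>y\<in>U. (double ^^ k) y = circ 0"
        by (intro exI[of _ k]) (auto simp: k_def)
    qed
  qed
  moreover have "circ 0 \<in> topspace (top_of_set (spiral h))"
    by (simp add: subsetD[OF circle_subset_spiral])
  ultimately show ?thesis
    unfolding is_alpha_limit_set_def using cont_double by (intro exI[of _ double]) blast
qed

lemma circle_path_leaves:
  assumes "closedin (top_of_set (spiral h)) A" "circ a \<in> A" "circ b \<notin> A"
  shows "is_alpha_limit_set (top_of_set (spiral h)) A"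
proof (rule is_alpha_limit_set_if_path_leaves[of _ _ 0 1 "\<lambda>t. circ ((1 - t) * a + t * b)"])
  show "continuous_on {0..1} (\<lambda>t. circ ((1 - t) * a + t * b))"
    unfolding circ_def by (intro continuous_intros)
  show "(\<lambda>t. circ ((1 - t) * a + t * b)) ` {0..1} \<subseteq> spiral h"
    using circle_subset_spiral[of h] circ_in_circle by blast
qed (use assms in auto)

lemma ray_path_leaves:
  assumes "closedin (top_of_set (spiral h)) A" "ray h u \<in> A" "ray h v \<notin> A" "u \<ge> 0" "v \<ge> 0"
  shows "is_alpha_limit_set (top_of_set (spiral h)) A"
proof (rule is_alpha_limit_set_if_path_leaves[of _ _ 0 1 "\<lambda>t. ray h ((1 - t) * u + t * v)"])
  have pos: "0 \<le> (1 - t) * u + t * v" if "t \<in> {0..1}" for t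
    using that assms by simp
  show "continuous_on {0..1} (\<lambda>t. ray h ((1 - t) * u + t * v))"
    by (rule continuous_on_compose2[OF continuous_on_ray])
       (use pos in \<open>auto intro!: continuous_intros\<close>)
  show "(\<lambda>t. ray h ((1 - t) * u + t * v)) ` {0..1} \<subseteq> spiral h"
    using pos by auto
qed (use assms in auto)

text \<open>A closed set that is left neither by the circle nor by the ray is a union of some of the two; if it contains the ray it
is everything, because the ray is dense.\<close>

theorem AF_property_spiral: "AF_property (top_of_set (spiral h))"
proof -
  have "is_alpha_limit_set (top_of_set (spiral h)) A" if A: "closedin (top_of_set (spiral h)) A" for A
  proof -
    have AS: "A \<subseteq> spiral h" using A closedin_imp_subset by blast
    consider (circle_meets) a b where "circ a \<in> A" "circ b \<notin> A"
      | (ray_meets) u v where "u \<ge> 0" "v \<ge> 0" "ray h u \<in> A" "ray h v \<notin> A"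
      | (ray_inside) "ray h ` {0..} \<subseteq> A"
      | (ray_outside) "ray h ` {0..} \<inter> A = {}" "circle \<subseteq> A \<or> circle \<inter> A = {}"
      by (auto simp: circle_def) 
    then show ?thesis
    proof cases
      case circle_meets
      then show ?thesis using A circle_path_leaves by blast
    next
      case ray_meets
      then show ?thesis using A ray_path_leaves by blast
    next
      case ray_inside
      have "closed A" using A compact_spiral closedin_closed_trans compact_imp_closed by blast
      then have "A = spiral h"
        using closure_minimal[OF ray_inside] AS spiral_eq_closure by auto
      then show ?thesis
        using is_alpha_limit_set_topspace[of "ray h 0" "top_of_set (spiral h)"] by simp
    next
      case ray_outside
      then have "A = circle \<or> A = {}" using AS unfolding spiral_def by blast
      moreover have "is_alpha_limit_set (top_of_set (spiral h)) {}"
      proof (rule is_alpha_limit_set_empty)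
        show "ray h 0 \<in> topspace (top_of_set (spiral h))" "circ 0 \<in> topspace (top_of_set (spiral h))"
          using circle_subset_spiral[of h] by auto
        show "ray h 0 \<noteq> circ 0" by (simp add: ray_def circ_def)
      qed
      ultimately show ?thesis using is_alpha_limit_set_circle by blast
    qed
  qed
  then show ?thesis
    unfolding AF_property_def by (auto simp: is_alpha_limit_set_def closedin_alpha_limit)
qed

end

section \<open>The two limit circles of a sum of unrelated spirals\<close>

lemma (in winding) constant_on_spiral:
  fixes g :: "complex \<times> real \<Rightarrow> 'a::t1_space"
  assumes "continuous_on (spiral h) g" "\<And>u. u \<ge> 0 \<Longrightarrow> g (ray h u) = y" "p \<in> spiral h"
  shows "g p = y"
proof (rule continuous_constant_on_closure[of "ray h ` {0..}" g y])
  show "continuous_on (closure (ray h ` {0..})) g" "p \<in> closure (ray h ` {0..})"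
    using assms(1,3) by (simp_all add: spiral_eq_closure)
qed (use assms(2) in auto)

text \<open>Near \<open>circ \<theta>\<close> the angle relative to \<open>\<theta>\<close> is a continuous function of the point.\<close>

lemma circ_locally_open:
  assumes "\<delta> > 0"
  obtains V where "open V" "circ \<theta> \<in> V" "V \<inter> circle \<subseteq> circ ` {\<theta> - \<delta><..<\<theta> + \<delta>}"
proof -
  define A where "A p = Arg (fst p * cis (- \<theta>))" for p :: "complex \<times> real"
  have one: "fst (circ \<theta>) * cis (- \<theta>) = 1" by (simp add: circ_def cis_mult)
  then have A0: "A (circ \<theta>) = 0" by (simp add: A_def)
  have "isCont A (circ \<theta>)"
    unfolding A_def
    by (rule isCont_o2[of _ "\<lambda>p. fst p * cis (- \<theta>)"])
       (auto simp: one intro!: continuous_intros continuous_at_Arg)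
  then have "(A \<longlongrightarrow> 0) (nhds (circ \<theta>))"
    using A0 by (metis isCont_def tendsto_at_iff_tendsto_nhds)
  then have "\<forall>\<^sub>F p in nhds (circ \<theta>). dist (A p) 0 < \<delta>"
    using assms by (rule tendstoD)
  then obtain V where V: "open V" "circ \<theta> \<in> V" "\<And>p. p \<in> V \<Longrightarrow> \<bar>A p\<bar> < \<delta>"
    unfolding eventually_nhds by auto
  have "p \<in> circ ` {\<theta> - \<delta><..<\<theta> + \<delta>}" if p: "p \<in> V" "p \<in> circle" for p
  proof -
    have n: "norm (fst p) = 1" "snd p = 0" using p(2) in_circle_iff by auto
    have "fst p * cis (- \<theta>) = cis (A p)"
      using rcis_cmod_Arg[of "fst p * cis (- \<theta>)"] n by (simp add: A_def rcis_def norm_mult)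
    then have "fst p * cis (- \<theta>) * cis \<theta> = cis (\<theta> + A p)" by (simp add: cis_mult add.commute)
    then have "fst p = cis (\<theta> + A p)" by (simp add: mult.assoc cis_mult)
    then have "p = circ (\<theta> + A p)" using n by (simp add: circ_def prod_eq_iff)
    moreover have "\<theta> + A p \<in> {\<theta> - \<delta><..<\<theta> + \<delta>}" using V(3)[OF p(1)] by auto
    ultimately show ?thesis by blast
  qed
  then show ?thesis using that[of V] V by blast
qed

text \<open>The interior of an interval longer than a full turn covers the circle. A shorter interval is bounded, so its
closure adds at most two end points to its interior.\<close>

lemma finite_closure_arc_minus_interior:
  fixes I :: "real set"
  assumes I: "connected I"
  shows "finite (closure (circ ` I) - circ ` interior I)"
proof (cases "\<exists>y\<in>I. \<exists>z\<in>I. z - y > 2 * pi")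
  case True
  then obtain y z where yz: "y \<in> I" "z \<in> I" "z - y > 2 * pi" by blast
  have "{y<..<z} \<subseteq> interior I"
    by (rule interior_maximal) (use connected_contains_Icc[OF I yz(1,2)] in auto)
  moreover have "p \<in> circ ` {y<..<z}" if p: "p \<in> circle" for p
  proof -
    obtain \<phi> where \<phi>: "p = circ \<phi>" using p by (auto simp: circle_def)
    define n where "n = \<lfloor>(y - \<phi>) / (2 * pi)\<rfloor> + 1"
    have "of_int n - 1 \<le> (y - \<phi>) / (2 * pi)" "(y - \<phi>) / (2 * pi) < of_int n"
      by (auto simp: n_def)
    then have "y < \<phi> + of_int n * (2 * pi)" "\<phi> + of_int n * (2 * pi) \<le> y + 2 * pi"
      by (simp_all add: field_simps)
    then have "\<phi> + of_int n * (2 * pi) \<in> {y<..<z}" using yz(3) by auto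
    moreover have "circ (\<phi> + of_int n * (2 * pi)) = p"
      unfolding \<phi> circ_def cis_mult[symmetric]
      using cis_multiple_2pi[of "of_int n"] by (simp add: mult.commute)
    ultimately show ?thesis by force
  qed
  moreover have "closure (circ ` I) \<subseteq> circle"
    by (rule closure_minimal) (auto simp: closed_circle)
  ultimately have "closure (circ ` I) - circ ` interior I = {}" by blast
  then show ?thesis by (metis finite.emptyI)
next
  case False
  show ?thesis
  proof (cases "I = {}")
    case nonempty: False
    then obtain y where y: "y \<in> I" by blast
    have "I \<subseteq> {y - 2 * pi..y + 2 * pi}"
      using False y by (force simp: not_less)
    then have bdd: "bounded I" using bounded_subset bounded_closed_interval by blast
    then have B: "bdd_above I" "bdd_below I" by (simp_all add: bounded_imp_bdd_above bounded_imp_bdd_below)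
    have frontier: "x \<in> {Inf I, Sup I}" if x: "x \<in> closure I" "x \<notin> interior I" for x
    proof -
      have "closure I \<subseteq> {Inf I..Sup I}"
        by (rule closure_minimal) (use B in \<open>auto intro: cInf_lower cSup_upper\<close>)
      then have "Inf I \<le> x" "x \<le> Sup I" using x by auto
      moreover have "x \<in> interior I" if lt: "Inf I < x" "x < Sup I"
      proof -
        obtain a b where ab: "a \<in> I" "a < x" "b \<in> I" "x < b"
          using lt cInf_less_iff[OF nonempty B(2)] less_cSup_iff[OF nonempty B(1)] by blast
        have "{a<..<b} \<subseteq> interior I"
          by (rule interior_maximal) (use connected_contains_Icc[OF I ab(1,3)] in auto)
        then show ?thesis using ab by auto
      qed
      ultimately show ?thesis using x(2) by fastforce
    qed
    have "closed (circ ` closure I)"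
      using bdd by (intro compact_imp_closed compact_continuous_image continuous_on_circ) simp
    then have "closure (circ ` I) \<subseteq> circ ` closure I"
      by (intro closure_minimal image_mono closure_subset)
    then have "closure (circ ` I) - circ ` interior I \<subseteq> circ ` {Inf I, Sup I}"
      using frontier by blast
    then show ?thesis by (rule finite_subset) simp
  qed simp
qed

text \<open>The situation to be refuted: the union of the two limit circles is an alpha-limit set. The booleans
index the two components.\<close>

locale two_circles_alpha_limit =
  fixes h :: "bool \<Rightarrow> real \<Rightarrow> real"
    and f :: "bool \<times> complex \<times> real \<Rightarrow> bool \<times> complex \<times> real"
    and x :: "bool \<times> complex \<times> real"
  assumes winding: "\<And>b. winding (h b)"
    and unrelated: "\<And>b. unrelated (h b) (h (\<not> b))"
    and f: "continuous_map (sum_topology (\<lambda>b. top_of_set (spiral (h b))) UNIV)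
              (sum_topology (\<lambda>b. top_of_set (spiral (h b))) UNIV) f"
    and alpha: "alpha_limit (sum_topology (\<lambda>b. top_of_set (spiral (h b))) UNIV) f x = UNIV \<times> circle"
begin

abbreviation S :: "bool \<Rightarrow> (complex \<times> real) set"
  where "S b \<equiv> spiral (h b)"

abbreviation Z :: "(bool \<times> complex \<times> real) topology"
  where "Z \<equiv> sum_topology (\<lambda>b. top_of_set (S b)) UNIV"

lemma circ_S [simp]: "circ \<theta> \<in> S b"
  by (rule subsetD[OF circle_subset_spiral circ_in_circle])

lemma circle_S: "p \<in> circle \<Longrightarrow> p \<in> S b"
  by (rule subsetD[OF circle_subset_spiral])

lemma openin_slice: "openin (top_of_set (S b)) V \<Longrightarrow> openin Z ({b} \<times> V)"
proof -
  assume "openin (top_of_set (S b)) V"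
  then have "openin Z (Pair b ` V)"
    using open_map_component_injection[of b UNIV "\<lambda>b. top_of_set (S b)"] by (simp add: open_map_def)
  moreover have "Pair b ` V = {b} \<times> V" by auto
  ultimately show ?thesis by simp
qed

lemma openin_preimage:
  assumes "openin Z U"
  shows "openin (top_of_set (S b)) {p \<in> S b. f (b, p) \<in> U}"
proof -
  have "continuous_map (top_of_set (S b)) Z (f \<circ> Pair b)"
    using continuous_map_compose[OF continuous_map_component_injection f] by simp
  then show ?thesis using assms by (auto simp: continuous_map_def)
qed

lemma f_in: "p \<in> S b \<Longrightarrow> snd (f (b, p)) \<in> S (fst (f (b, p)))"
proof -
  assume "p \<in> S b"
  then have "(b, p) \<in> topspace Z" by simp
  then have "f (b, p) \<in> topspace Z"
    using continuous_map_image_subset_topspace[OF f] by blast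
  then show ?thesis by (simp add: mem_Sigma_iff mem_Times_iff split_beta Sigma_def) auto
qed

definition \<sigma> :: "bool \<Rightarrow> bool"
  where "\<sigma> b = fst (f (b, circ 0))"

definition g :: "bool \<Rightarrow> complex \<times> real \<Rightarrow> complex \<times> real"
  where "g b p = snd (f (b, p))"

lemma fst_f: "p \<in> S b \<Longrightarrow> fst (f (b, p)) = \<sigma> b"
proof -
  assume p: "p \<in> S b"
  \<comment> \<open>A component is connected, so \<open>f\<close> cannot send parts of it to different components.\<close>
  define E where "E c = {q \<in> S b. f (b, q) \<in> {c} \<times> S c}" for c
  have E: "E c = {q \<in> S b. fst (f (b, q)) = c}" for c
    using f_in[of _ b] unfolding E_def by (auto simp: mem_Times_iff)
  have "openin (top_of_set (S b)) (E c)" for c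
    unfolding E_def by (intro openin_preimage openin_slice openin_subtopology_self)
  moreover have "S b \<subseteq> E True \<union> E False" "E True \<inter> E False = {}" unfolding E by auto
  moreover have "connected (S b)" using winding winding.connected_spiral by blast
  ultimately have "E True = {} \<or> E False = {}" unfolding connected_openin by blast
  moreover have "p \<in> E (fst (f (b, p)))" "circ 0 \<in> E (\<sigma> b)" using p by (simp_all add: E \<sigma>_def)
  ultimately show ?thesis by (cases "fst (f (b, p))"; cases "\<sigma> b") auto
qed

lemma f_eq: "p \<in> S b \<Longrightarrow> f (b, p) = (\<sigma> b, g b p)"
  by (simp add: prod_eq_iff g_def fst_f)

lemma g_in: "p \<in> S b \<Longrightarrow> g b p \<in> S (\<sigma> b)"
proof -
  assume p: "p \<in> S b"
  show ?thesis using f_in[OF p] unfolding fst_f[OF p] g_def .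
qed

lemma g_continuous: "continuous_on (S b) (g b)"
proof -
  have "openin (top_of_set (S b)) {p \<in> S b. g b p \<in> V}" if "openin (top_of_set (S (\<sigma> b))) V" for V
  proof -
    have "{p \<in> S b. g b p \<in> V} = {p \<in> S b. f (b, p) \<in> {\<sigma> b} \<times> V}"
      using f_eq by auto
    then show ?thesis using openin_preimage[OF openin_slice[OF that]] by simp
  qed
  then have "continuous_map (top_of_set (S b)) (top_of_set (S (\<sigma> b))) (g b)"
    using g_in by (auto simp: continuous_map_def)
  then show ?thesis by simp
qed

lemma g_circle: "p \<in> circle \<Longrightarrow> g b p \<in> circle"
proof -
  assume p: "p \<in> circle"
  then have "(b, p) \<in> alpha_limit Z f x" unfolding alpha by blast
  from alpha_limit_forward_invariant[OF f this] have "f (b, p) \<in> UNIV \<times> circle"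
    unfolding alpha .
  then show ?thesis unfolding f_eq[OF circle_S[OF p]] by blast
qed

lemma spiral_map_g: "spiral_map (h b) (h (\<sigma> b)) (g b)"
  unfolding spiral_map_def spiral_map_axioms_def
  by (intro conjI winding g_continuous image_subsetI g_in g_circle)

lemma alpha_approached:
  assumes "p \<in> circle" "openin (top_of_set (S b)) V" "p \<in> V"
  obtains k q where "k \<ge> n" "q \<in> V" "q \<in> S b" "(f ^^ k) (b, q) = x"
proof -
  have "(b, p) \<in> alpha_limit Z f x" using alpha assms(1) by simp
  then obtain k y where "k \<ge> n" "y \<in> {b} \<times> V" "(f ^^ k) y = x"
    using openin_slice[OF assms(2)] assms(3) unfolding in_alpha_limit_iff
    by (metis SigmaI singletonI)
  then show ?thesis using that[of k "snd y"] openin_imp_subset[OF assms(2)] by auto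
qed

text \<open>The alpha-limit set contains no point of a ray.\<close>

lemma compact_ray_escapes:
  obtains n where "\<And>k u. \<lbrakk>k \<ge> n; u \<in> {0..N}\<rbrakk> \<Longrightarrow> (f ^^ k) (b, ray (h b) u) \<noteq> x"
proof (rule ccontr)
  assume "\<not> thesis"
  then have inf: "\<exists>k\<ge>n. \<exists>y \<in> (\<lambda>u. (b, ray (h b) u)) ` {0..N}. (f ^^ k) y = x" for n
    using that by blast
  have "continuous_on {0..N} (ray (h b))"
    by (rule continuous_on_subset[OF winding.continuous_on_ray[OF winding]]) auto
  then have "continuous_map (top_of_set {0..N}) (top_of_set (S b)) (ray (h b))" by auto
  then have "continuous_map (top_of_set {0..N}) Z (Pair b \<circ> ray (h b))"
    by (rule continuous_map_compose)
       (rule continuous_map_component_injection[of b UNIV "\<lambda>b. top_of_set (S b)", OF UNIV_I])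
  moreover have "compactin (top_of_set {0..N}) {0..N}" by (simp add: compactin_subtopology)
  ultimately have "compactin Z ((Pair b \<circ> ray (h b)) ` {0..N})"
    using image_compactin by blast
  then have "(\<lambda>u. (b, ray (h b) u)) ` {0..N} \<inter> (UNIV \<times> circle) \<noteq> {}"
    using alpha_limit_meets_compact[of Z, OF _ inf] unfolding alpha o_def by blast
  then obtain u where "u \<ge> 0" "ray (h b) u \<in> circle" by auto
  then show False using snd_ray_pos[of u "h b"] in_circle_iff by simp
qed

text \<open>If an iterate is constant on a component, then each later preimage of \<open>x\<close> contains all of that component or none of it.
As it approaches the circle infinitely often, it would also contain a point of the ray infinitely often.\<close>

lemma iterate_not_constant:
  assumes "\<And>p. p \<in> S b \<Longrightarrow> (f ^^ j) (b, p) = y"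
  shows False
proof -
  obtain n where n: "\<And>k u. \<lbrakk>k \<ge> n; u \<in> {0..0}\<rbrakk> \<Longrightarrow> (f ^^ k) (b, ray (h b) u) \<noteq> x"
    using compact_ray_escapes by blast
  obtain k q where k: "k \<ge> max n j" "q \<in> S b" "(f ^^ k) (b, q) = x"
    using alpha_approached[OF circ_in_circle[of 0] openin_subtopology_self circ_S] by metis
  have "(f ^^ k) (b, p) = (f ^^ (k - j)) y" if "p \<in> S b" for p
    using assms[OF that] k(1) funpow_add[of "k - j" j f] by simp
  then have "(f ^^ k) (b, ray (h b) 0) = x" using k by simp
  then show False using n[of k 0] k(1) by simp
qed

lemma into_circle_if_swapped:
  assumes "\<sigma> b = (\<not> b)"
  shows "g b ` S b \<subseteq> circle"
proof (rule spiral_map.unrelated_imp_into_circle[OF spiral_map_g])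
  show "unrelated (h b) (h (\<sigma> b))" unfolding assms by (rule unrelated)
qed

lemma some_component_swapped:
  obtains c where "\<sigma> c = (\<not> c)"
proof (rule ccontr)
  assume "\<not> thesis"
  then have stay: "\<sigma> b = b" for b using that by blast
  have iter: "q \<in> S b \<Longrightarrow> (f ^^ k) (b, q) \<in> {b} \<times> S b" for b k q
  proof (induction k)
    case (Suc k)
    then obtain q' where "(f ^^ k) (b, q) = (b, q')" "q' \<in> S b" by auto
    then show ?case using f_eq[of q' b] g_in[of q' b] stay[of b] by simp
  qed simp
  obtain k q where "q \<in> S (\<not> fst x)" "(f ^^ k) (\<not> fst x, q) = x"
    using alpha_approached[OF circ_in_circle[of 0] openin_subtopology_self circ_S] by metis
  then show False using iter[of q "\<not> fst x" k] by auto
qed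

text \<open>\<open>f\<^sup>-\<^sup>k(x)\<close>, restricted to the circle of component \<open>b\<close>, keeps away from \<open>p\<close> for large \<open>k\<close>.\<close>

definition shielded :: "bool \<Rightarrow> complex \<times> real \<Rightarrow> bool"
  where "shielded b p \<longleftrightarrow>
    (\<exists>V n. open V \<and> p \<in> V \<and> (\<forall>k\<ge>n. \<forall>q\<in>V \<inter> circle. (f ^^ k) (b, q) \<noteq> x))"

text \<open>The interval \<open>I\<close> consists of the angles of the image of the ray. Around an interior angle, a whole
neighbourhood on the circle is the image of a compact part of the ray, and this part misses the late
preimages of \<open>x\<close>.\<close>

lemma arc_avoids_preimages:
  assumes into: "g b ` S b \<subseteq> circle"
  shows "\<exists>I. connected I \<and> interior I \<noteq> {} \<and> g b ` S b \<subseteq> closure (circ ` I) \<and>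
    (\<forall>\<theta>\<in>interior I. shielded (\<sigma> b) (circ \<theta>))"
proof -
  interpret spiral_map "h b" "h (\<sigma> b)" "g b" by (rule spiral_map_g)
  obtain G where G: "continuous_on {0..} G" "\<And>u. u \<ge> 0 \<Longrightarrow> fst (g b (ray (h b) u)) = cis (G u)"
    using lift_exists by metis
  have gG: "g b (ray (h b) u) = circ (G u)" if "u \<ge> 0" for u
  proof -
    have "g b (ray (h b) u) \<in> circle" using into that by auto
    then show ?thesis using G(2)[OF that] by (simp add: in_circle_iff circ_def prod_eq_iff)
  qed
  define I where "I = G ` {0..}"
  have conn: "connected I" unfolding I_def by (intro connected_continuous_image G) simp
  have int: "interior I \<noteq> {}"
  proof
    assume empty: "interior I = {}"
    have const: "G u = G 0" if "u \<ge> 0" for u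
    proof (rule ccontr)
      assume "G u \<noteq> G 0"
      define l m where "l = min (G u) (G 0)" and "m = max (G u) (G 0)"
      have lm: "l < m" "l \<in> I" "m \<in> I"
        using \<open>G u \<noteq> G 0\<close> that by (auto simp: l_def m_def I_def min_def max_def)
      have "{l<..<m} \<subseteq> interior I"
        by (rule interior_maximal) (use connected_contains_Icc[OF conn lm(2,3)] in auto)
      moreover have "(l + m) / 2 \<in> {l<..<m}" using lm(1) by simp
      ultimately show False using empty by blast
    qed
    have "g b p = circ (G 0)" if "p \<in> S b" for p
    proof (rule W1.constant_on_spiral[OF gcont _ that])
      show "g b (ray (h b) u) = circ (G 0)" if "u \<ge> 0" for u
        using gG[OF that] const[OF that] by metis
    qed
    then have "(f ^^ 1) (b, p) = (\<sigma> b, circ (G 0))" if "p \<in> S b" for p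
      using f_eq[OF that] that unfolding One_nat_def funpow.simps o_apply id_apply by metis
    then show False by (rule iterate_not_constant)
  qed
  have img: "g b ` S b \<subseteq> closure (circ ` I)"
  proof -
    have "g b ` closure (ray (h b) ` {0..}) \<subseteq> closure (circ ` I)"
    proof (rule image_closure_subset)
      show "continuous_on (closure (ray (h b) ` {0..})) (g b)"
        using gcont by (simp add: W1.spiral_eq_closure)
      show "g b ` ray (h b) ` {0..} \<subseteq> closure (circ ` I)"
        using gG closure_subset[of "circ ` I"] by (auto simp: I_def)
    qed simp
    then show ?thesis by (simp add: W1.spiral_eq_closure)
  qed
  have "shielded (\<sigma> b) (circ \<theta>)"
    if \<theta>: "\<theta> \<in> interior I" for \<theta>
  proof -
    obtain e where e: "e > 0" "cball \<theta> e \<subseteq> I"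
      using \<theta> by (meson mem_interior_cball)
    then have "\<theta> - e \<in> I" "\<theta> + e \<in> I" by (auto simp: subset_iff dist_real_def)
    then obtain u1 u2 where u: "u1 \<ge> 0" "G u1 = \<theta> - e" "u2 \<ge> 0" "G u2 = \<theta> + e"
      by (auto simp: I_def)
    define N where "N = max u1 u2"
    have "connected (G ` {0..N})"
      by (intro connected_continuous_image continuous_on_subset[OF G(1)]) auto
    moreover have "u1 \<in> {0..N}" "u2 \<in> {0..N}" using u by (auto simp: N_def)
    then have "\<theta> - e \<in> G ` {0..N}" "\<theta> + e \<in> G ` {0..N}"
      using u(2,4) by (metis imageI)+
    ultimately have sub: "{\<theta> - e..\<theta> + e} \<subseteq> G ` {0..N}"
      using connected_contains_Icc by blast
    obtain n where n: "\<And>k u. \<lbrakk>k \<ge> n; u \<in> {0..N}\<rbrakk> \<Longrightarrow> (f ^^ k) (b, ray (h b) u) \<noteq> x"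
      using compact_ray_escapes by blast
    obtain V where V: "open V" "circ \<theta> \<in> V" "V \<inter> circle \<subseteq> circ ` {\<theta> - e<..<\<theta> + e}"
      using circ_locally_open[OF e(1)] by blast
    have "(f ^^ k) (\<sigma> b, q) \<noteq> x" if k: "k \<ge> n" and q: "q \<in> V \<inter> circle" for k q
    proof -
      obtain \<phi> where \<phi>: "\<phi> \<in> {\<theta> - e<..<\<theta> + e}" "q = circ \<phi>" using q V(3) by blast
      then have "\<phi> \<in> {\<theta> - e..\<theta> + e}" by simp
      then obtain u where u: "u \<in> {0..N}" "\<phi> = G u" using sub by blast
      then have "f (b, ray (h b) u) = (\<sigma> b, q)" using f_eq \<phi> gG by simp
      then have "(f ^^ Suc k) (b, ray (h b) u) = (f ^^ k) (\<sigma> b, q)"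
        by (simp add: funpow_swap1)
      then show ?thesis using n[of "Suc k" u] u k by simp
    qed
    then show ?thesis using V unfolding shielded_def by blast
  qed
  then show ?thesis using conn int img by blast
qed

text \<open>A component \<open>c\<close> that goes to the other one goes into its circle. If the other component \<open>c'\<close> is mapped to itself with
ray going to ray, then near a shielded point of its circle the late preimages of \<open>x\<close> must lie on the ray, and
so \<open>x\<close> is on the ray. But the orbits that start in \<open>c\<close> enter the circle at once and never leave it, so they cannot reach \<open>x\<close>.\<close>

lemma all_into_circle: "g b ` S b \<subseteq> circle"
proof -
  obtain c where c: "\<sigma> c = (\<not> c)" using some_component_swapped .
  define c' where "c' = (\<not> c)"
  have gc: "g c ` S c \<subseteq> circle" using into_circle_if_swapped[OF c] .
  have "g c' ` S c' \<subseteq> circle"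
  proof (cases "\<sigma> c' = c'")
    case False
    then have "\<sigma> c' = (\<not> c')" by (cases c') auto
    then show ?thesis by (rule into_circle_if_swapped)
  next
    case stay: True
    interpret spiral_map "h c'" "h c'" "g c'" using spiral_map_g[of c'] stay by simp
    show ?thesis
    proof (rule image_cases)
      assume pos: "\<And>u. u \<ge> 0 \<Longrightarrow> snd (g c' (ray (h c') u)) > 0"
      obtain I where I: "connected I" "interior I \<noteq> {}" "g c ` S c \<subseteq> closure (circ ` I)"
        "\<forall>\<theta>\<in>interior I. shielded (\<sigma> c) (circ \<theta>)"
        using arc_avoids_preimages[OF gc] by auto
      obtain \<theta> where "\<theta> \<in> interior I" using I(2) by blast
      then obtain V n where V: "open V" "circ \<theta> \<in> V"
        and n: "\<And>k q. \<lbrakk>k \<ge> n; q \<in> V \<inter> circle\<rbrakk> \<Longrightarrow> (f ^^ k) (\<sigma> c, q) \<noteq> x"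
        using I(4) unfolding shielded_def by meson
      have "openin (top_of_set (S c')) (S c' \<inter> V)" using V(1) by (simp add: openin_open_Int)
      then obtain k q where kq: "k \<ge> n" "q \<in> S c' \<inter> V" "(f ^^ k) (c', q) = x"
        using alpha_approached[OF circ_in_circle[of \<theta>], of c' "S c' \<inter> V" n] V(2) circ_S
        by (metis IntI)
      then have "q \<notin> circle" using n[of k q] c by (auto simp: c'_def)
      then have q: "snd q > 0"
        using kq(2) spiral_in_circle_iff spiral_snd_nonneg by (metis IntE order_less_le)
      have iter: "\<exists>p. (f ^^ k) (c', q) = (c', p) \<and> p \<in> S c' \<and> snd p > 0" for k
      proof (induction k)
        case 0
        then show ?case using kq(2) q by auto
      next
        case (Suc k)
        then obtain p where p: "(f ^^ k) (c', q) = (c', p)" "p \<in> S c'" "snd p > 0" by blast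
        then have "snd (g c' p) > 0" using pos spiral_pos_eq_ray by metis
        then show ?case using p f_eq[of p c'] g_in[of p c'] stay by simp
      qed
      have "snd (snd x) > 0" using iter[of k] kq(3) by auto
      obtain m p where mp: "m \<ge> 1" "p \<in> S c" "(f ^^ m) (c, p) = x"
        using alpha_approached[OF circ_in_circle[of 0] openin_subtopology_self circ_S] by metis
      have stays_in_circle: "\<exists>r\<in>circle. (f ^^ Suc j) (c, p) = (c', r)" for j
      proof (induction j)
        case 0
        then show ?case using f_eq[OF mp(2)] gc mp(2) c by (auto simp: c'_def)
      next
        case (Suc j)
        then obtain r where "r \<in> circle" "(f ^^ Suc j) (c, p) = (c', r)" by blast
        then show ?case using f_eq[OF circle_S, of r c'] g_circle[of r c'] stay by simp
      qed
      have "snd (snd x) = 0"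
        using stays_in_circle[of "m - 1"] mp(1,3) in_circle_iff by auto
      then show ?thesis using \<open>snd (snd x) > 0\<close> by simp
    qed
  qed
  then show ?thesis using gc by (cases "b = c") (auto simp: c'_def)
qed

text \<open>A point of the circle that went into the interior of the arc would be approached by late preimages of \<open>x\<close>, whose images
are again late preimages of \<open>x\<close> on the target circle, at a shielded point. So the circle goes into the finite set of
end points of the arc, and it is connected.\<close>

lemma g_constant_on_circle:
  shows "\<exists>e. \<forall>p\<in>circle. g b p = e"
proof -
  from arc_avoids_preimages[OF all_into_circle[of b]]
  obtain I where I: "connected I" "interior I \<noteq> {}" "g b ` S b \<subseteq> closure (circ ` I)"
    "\<forall>\<theta>\<in>interior I. shielded (\<sigma> b) (circ \<theta>)"
    by (elim exE conjE)
  have avoid: "g b p \<notin> circ ` interior I" if p: "p \<in> circle" for p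
  proof
    assume "g b p \<in> circ ` interior I"
    then have "shielded (\<sigma> b) (g b p)" using I(4) by auto
    then obtain V n where V: "open V" "g b p \<in> V"
      and n: "\<And>k q. \<lbrakk>k \<ge> n; q \<in> V \<inter> circle\<rbrakk> \<Longrightarrow> (f ^^ k) (\<sigma> b, q) \<noteq> x"
      unfolding shielded_def by meson
    have open_pre: "openin (top_of_set (S b)) (S b \<inter> g b -` V)"
      using g_continuous V(1) by (rule continuous_openin_preimage_gen)
    have "p \<in> S b \<inter> g b -` V" using V(2) circle_S[OF p] by simp
    from alpha_approached[OF p open_pre this] obtain k q
      where kq: "k \<ge> Suc n" "q \<in> S b \<inter> g b -` V" "(f ^^ k) (b, q) = x"
      by metis
    obtain m where m: "k = Suc m" using kq(1) by (cases k) auto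
    have "(f ^^ k) (b, q) = (f ^^ m) (\<sigma> b, g b q)"
      using f_eq[of q b] kq(2) by (simp add: m funpow_swap1)
    moreover have "g b q \<in> V \<inter> circle" using kq(2) all_into_circle by auto
    ultimately show False using n[of m "g b q"] kq m by simp
  qed
  have "g b ` circle \<subseteq> closure (circ ` I) - circ ` interior I"
    by (intro image_subsetI DiffI subsetD[OF I(3)] imageI circle_S avoid)
  then have "finite (g b ` circle)"
    by (rule finite_subset[OF _ finite_closure_arc_minus_interior[OF I(1)]])
  moreover have "connected (g b ` circle)"
    by (intro connected_continuous_image continuous_on_subset[OF g_continuous circle_subset_spiral] connected_circle)
  moreover have "g b ` circle \<noteq> {}" using circ_in_circle[of 0] by blast
  ultimately obtain e where "g b ` circle = {e}"
    using connected_finite_iff_sing[of "g b ` circle"] by metis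
  then show ?thesis by blast
qed

theorem contradiction: False
proof -
  obtain e where e: "\<And>p. p \<in> circle \<Longrightarrow> g (\<sigma> True) p = e"
    using g_constant_on_circle by blast
  have "(f ^^ 2) (True, p) = (\<sigma> (\<sigma> True), e)" if p: "p \<in> S True" for p
  proof -
    have "g True p \<in> circle" using all_into_circle p by blast
    then show ?thesis
      using f_eq[OF p] f_eq[OF circle_S, of "g True p" "\<sigma> True"] e by (simp add: numeral_2_eq_2)
  qed
  then show False by (rule iterate_not_constant)
qed

end

theorem sum_of_unrelated_spirals_not_AF:
  assumes "\<And>b. winding (h b)" "\<And>b. unrelated (h b) (h (\<not> b))"
  shows "\<not> AF_property (sum_topology (\<lambda>b. top_of_set (spiral (h b))) UNIV)"
    (is "\<not> AF_property ?Z")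
proof
  assume AF: "AF_property ?Z"
  have "closedin (top_of_set (spiral (h b))) circle" for b
    by (metis Int_absorb1 circle_subset_spiral closed_circle closedin_closed_Int)
  then have "closedin ?Z (UNIV \<times> circle)"
    by (simp add: closedin_disjoint_union)
  then have "is_alpha_limit_set ?Z (UNIV \<times> circle)"
    using AF by (auto simp: AF_property_def)
  then obtain f x where "continuous_map ?Z ?Z f" "alpha_limit ?Z f x = UNIV \<times> circle"
    by (auto simp: is_alpha_limit_set_def)
  then interpret two_circles_alpha_limit h f x
    using assms by (simp add: two_circles_alpha_limit_def)
  show False by (rule contradiction)
qed

section \<open>Two unrelated spirals\<close>

text \<open>Doubling \<open>u\<close> adds one full turn to the argument of the sine, hence \<open>osc (2 * u) = 2 * osc u\<close>. The factor \<open>u\<close> makes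
the swings unbounded in both directions.\<close>

definition osc :: "real \<Rightarrow> real"
  where "osc u = u * sin (2 * pi * log 2 u)"

lemma osc_peaks:
  obtains u where "u \<ge> N" "u \<ge> 0" "osc u = u"
proof -
  obtain n :: nat where n: "N < 2 ^ n" using real_arch_pow[of 2 N] by auto
  define u :: real where "u = 2 powr (n + 1 / 4)"
  have "2 ^ n \<le> u" by (simp add: u_def powr_add powr_realpow ge_one_powr_ge_zero)
  moreover have angle: "2 * pi * log 2 u = pi / 2 + 2 * real n * pi"
    by (simp add: u_def algebra_simps)
  have "osc u = u"
    unfolding osc_def angle sin_add sin_2npi cos_2npi by simp
  ultimately show ?thesis using that[of u] n by (simp add: u_def)
qed

lemma osc_troughs:
  obtains u where "u \<ge> N" "u \<ge> 0" "osc u = - u"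
proof -
  obtain n :: nat where n: "N < 2 ^ n" using real_arch_pow[of 2 N] by auto
  define u :: real where "u = 2 powr (n + 3 / 4)"
  have "2 ^ n \<le> u" by (simp add: u_def powr_add powr_realpow ge_one_powr_ge_zero)
  moreover have angle: "2 * pi * log 2 u = 3 / 2 * pi + 2 * real n * pi"
    by (simp add: u_def algebra_simps)
  have "osc u = - u"
    unfolding osc_def angle sin_add sin_2npi cos_2npi sin_3over2_pi by simp
  ultimately show ?thesis using that[of u] n by (simp add: u_def)
qed

lemma osc_zero: "osc (2 ^ n) = 0"
proof -
  have "2 * pi * log 2 (2 ^ n) = 2 * real n * pi" by (simp add: log_nat_power)
  then show ?thesis unfolding osc_def by (simp only: sin_2npi mult_zero_right)
qed

lemma winding_id: "winding id"
proof
  show "\<exists>u\<ge>N. M \<le> id u" for N M :: real by (intro exI[of _ "max N M"]) auto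
qed (auto simp: continuous_on_id)

lemma winding_osc: "winding osc"
proof
  have "continuous (at u within {0..}) osc" if "u \<ge> 0" for u
  proof (cases "u = 0")
    case True
    have "(osc \<longlongrightarrow> 0) (at 0 within {0..})"
    proof (rule Lim_null_comparison)
      show "\<forall>\<^sub>F u in at 0 within {0..}. norm (osc u) \<le> \<bar>u\<bar>"
        by (rule always_eventually) (simp add: osc_def abs_mult mult_left_le abs_sin_le_one)
      show "((\<lambda>u::real. \<bar>u\<bar>) \<longlongrightarrow> 0) (at 0 within {0..})"
        by (rule tendsto_eq_intros | simp)+
    qed
    then show ?thesis using True by (simp add: continuous_within osc_def)
  next
    case False
    then have "isCont osc u"
      unfolding osc_def using that by (intro continuous_intros) auto
    then show ?thesis by (rule continuous_at_imp_continuous_at_within)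
  qed
  then show "continuous_on {0..} osc" by (simp add: continuous_on_eq_continuous_within)
  show "osc (2 * u) = 2 * osc u" if "u \<ge> 0" for u
  proof (cases "u = 0")
    case False
    then have "log 2 (2 * u) = log 2 u + 1" using that by (simp add: log_mult)
    then show ?thesis by (simp add: osc_def distrib_left)
  qed (simp add: osc_def)
  show "\<exists>u\<ge>N. M \<le> osc u" for N M
    using osc_peaks[of "max N M"] by (metis max.bounded_iff)
qed

text \<open>\<open>\<psi>\<close> takes all large values, so \<open>osc (\<psi> u)\<close> is unbounded in both directions, whereas \<open>d * u\<close> is bounded on
one side.\<close>

lemma unrelated_id_osc: "unrelated id osc"
  unfolding unrelated_def
proof (intro allI impI)
  fix \<psi> :: "real \<Rightarrow> real" and d B :: real
  assume \<psi>: "continuous_on {0..} \<psi> \<and> filterlim \<psi> at_top at_top"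
  have onto: "\<exists>u\<ge>0. \<psi> u = v" if v: "v \<ge> \<psi> 0" for v
  proof -
    have "\<forall>\<^sub>F u in at_top. v \<le> \<psi> u" using \<psi> by (auto simp: filterlim_at_top)
    then obtain w where w: "\<And>u. u \<ge> w \<Longrightarrow> v \<le> \<psi> u" by (auto simp: eventually_at_top_linorder)
    have "continuous_on {0..max 0 w} \<psi>" using \<psi> continuous_on_subset by force
    then obtain u where "0 \<le> u" "\<psi> u = v"
      using IVT'[of \<psi> 0 v "max 0 w"] v w[of "max 0 w"] by auto
    then show ?thesis by blast
  qed
  show "\<exists>u\<ge>0. B < \<bar>osc (\<psi> u) - d * id u\<bar>"
  proof (cases "d \<ge> 0")
    case True
    obtain v where v: "v \<ge> max (\<psi> 0) (\<bar>B\<bar> + 1)" "osc v = - v" using osc_troughs by blast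
    then obtain u where "u \<ge> 0" "\<psi> u = v" using onto[of v] by auto
    moreover from this have "d * u \<ge> 0" using True by simp
    ultimately show ?thesis using v by (intro exI[of _ u]) auto
  next
    case False
    obtain v where v: "v \<ge> max (\<psi> 0) (\<bar>B\<bar> + 1)" "osc v = v" using osc_peaks by blast
    then obtain u where "u \<ge> 0" "\<psi> u = v" using onto[of v] by auto
    moreover from this have "d * u \<le> 0" using False by (simp add: mult_nonpos_nonneg)
    ultimately show ?thesis using v by (intro exI[of _ u]) auto
  qed
qed

text \<open>\<open>osc\<close> has arbitrarily large zeros, but \<open>\<psi>\<close> tends to infinity.\<close>

lemma unrelated_osc_id: "unrelated osc id"
  unfolding unrelated_def
proof (intro allI impI)
  fix \<psi> :: "real \<Rightarrow> real" and d B :: real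
  assume "continuous_on {0..} \<psi> \<and> filterlim \<psi> at_top at_top"
  then have "\<forall>\<^sub>F u in at_top. \<bar>B\<bar> + 1 \<le> \<psi> u" by (auto simp: filterlim_at_top)
  then obtain w where w: "\<And>u. u \<ge> w \<Longrightarrow> \<bar>B\<bar> + 1 \<le> \<psi> u" by (auto simp: eventually_at_top_linorder)
  obtain n :: nat where "w < 2 ^ n" using real_arch_pow[of 2 w] by auto
  then have "B < \<bar>id (\<psi> (2 ^ n)) - d * osc (2 ^ n)\<bar>"
    using w[of "2 ^ n"] by (simp add: osc_zero)
  then show "\<exists>u\<ge>0. B < \<bar>id (\<psi> u) - d * osc u\<bar>"
    by (intro exI[of _ "2 ^ n"]) auto
qed

section \<open>The pair of continua\<close>

text \<open>An embedding into the type of real sequences, in which the required pair of spaces must live; all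
coordinates from index \<open>2\<close> on repeat the height.\<close>

definition coords :: "complex \<times> real \<Rightarrow> nat \<Rightarrow> real"
  where "coords p n = (if n = 0 then Re (fst p) else if n = 1 then Im (fst p) else snd p)"

lemma homeomorphic_coords: "top_of_set S homeomorphic_space top_of_set (coords ` S)"
proof -
  define r where "r v = (Complex (v 0) (v 1), v 2)" for v :: "nat \<Rightarrow> real"
  have r: "r (coords p) = p" for p by (simp add: r_def coords_def)
  have "continuous_on S (\<lambda>p. coords p n)" for n
    unfolding coords_def by (cases "n = 0"; cases "n = 1") (auto intro!: continuous_intros)
  then have "continuous_on S coords" by (rule continuous_on_coordinatewise_then_product)
  moreover have "continuous_on (coords ` S) (\<lambda>v. v n)" for n
    by (rule continuous_on_subset[OF continuous_on_product_coordinates]) simp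
  then have "continuous_on (coords ` S) r"
    unfolding r_def Complex_eq by (intro continuous_intros)
  ultimately have "homeomorphic_maps (top_of_set S) (top_of_set (coords ` S)) coords r"
    by (auto simp: homeomorphic_maps_def r)
  then show ?thesis by (auto simp: homeomorphic_space_def)
qed

theorem theorem17:
  shows "\<exists>X Y :: (nat \<Rightarrow> real) topology.
    connected_space X \<and> compact_space X \<and> metrizable_space X \<and> AF_property X \<and>
    connected_space Y \<and> compact_space Y \<and> metrizable_space Y \<and> AF_property Y \<and>
    \<not> AF_property (binary_sum_topology X Y)"
proof -
  define h where "h b = (if b then id else osc)" for b :: bool
  have W: "winding (h b)" for b by (simp add: h_def winding_id winding_osc)
  have U: "unrelated (h b) (h (\<not> b))" for b
    by (simp add: h_def unrelated_id_osc unrelated_osc_id)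
  define T where "T b = top_of_set (coords ` spiral (h b))" for b
  have hom: "top_of_set (spiral (h b)) homeomorphic_space T b" for b
    unfolding T_def by (rule homeomorphic_coords)
  have conn: "connected_space (T b)" for b
    using homeomorphic_connected_space[OF hom[of b]] winding.connected_spiral[OF W[of b]]
    by (metis connectedin_def connectedin_iff_connected)
  have comp: "compact_space (T b)" for b
    using homeomorphic_compact_space[OF hom[of b]] winding.compact_spiral[OF W[of b]]
    by (metis compact_space_subtopology compactin_euclidean_iff)
  have metr: "metrizable_space (T b)" for b
    unfolding T_def by (rule metrizable_space_subtopology[OF metrizable_space_euclidean])
  have AF: "AF_property (T b)" for b
    using AF_property_homeomorphic[OF hom winding.AF_property_spiral[OF W]] .
  have "sum_topology T UNIV homeomorphic_space sum_topology (\<lambda>b. top_of_set (spiral (h b))) UNIV"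
    by (rule sum_topology_homeomorphic, rule homeomorphic_space_sym[THEN iffD1, OF hom])
  from AF_property_homeomorphic[OF this] have "\<not> AF_property (sum_topology T UNIV)"
    using sum_of_unrelated_spirals_not_AF[of h, OF W U] by (rule contrapos_nn[rotated])
  moreover have "(\<lambda>b. if b then T True else T False) = T" by (rule ext) simp
  ultimately have "\<not> AF_property (binary_sum_topology (T True) (T False))"
    by (simp only: binary_sum_topology_def not_False_eq_True)
  then show ?thesis
    by (intro exI[of _ "T True"] exI[of _ "T False"] conjI conn comp metr AF)
qed

end
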